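(* Let $A$ be a C$^*$-algebra with cancellation. If $A$ has real rank zero and $K_0(A)^+=D_0(A)$, then for all $a,b\in A$ and all $g,h\in K_0(A)^+$, \[ s_{g+h}(ab)\leq s_g(a)\,s_h(b). \]
   Context: For a C$^*$-algebra $A$, $P(A)$ denotes the set of projections of $A$, $K_0(A)$ is the usual $K_0$-group with positive cone $K_0(A)^+=\{[p]_0 : p \text{ a projection in } M_n(A) \text{ for some } n\geq 1\}$, and for $g,h\in K_0(A)$ we write $g\leq h$ if $h-g\in K_0(A)^+$. The dimension range is $D_0(A)=\{[p]_0\mid p\in P(A)\}$. $A$ has cancellation if for all projections $p,q$ in $\bigcup_{n\geq1}M_n(A)$, $[p]_0=[q]_0$ if and only if $p$ and $q$ are Murray--von Neumann equivalent. The singular value function of $a\in A$ is the function $s(a)\colon K_0(A)^+\to[0,\infty)$ defined by \[ s_g(a):=\inf\{\|a-ap\| \mid p\in P(A),\ [p]_0\leq g\},\qquad g\in K_0(A)^+. \] *)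

theory Defs
  imports "HOL-Analysis.Analysis"
begin

definition cstar_algebra ::
  "(complex \<Rightarrow> 'a::{real_normed_algebra,banach} \<Rightarrow> 'a) \<Rightarrow> ('a \<Rightarrow> 'a) \<Rightarrow> bool" where
  "cstar_algebra csc star \<longleftrightarrow>
     (\<forall>x. csc 1 x = x) \<and>
     (\<forall>c d x. csc (c * d) x = csc c (csc d x)) \<and>
     (\<forall>c d x. csc (c + d) x = csc c x + csc d x) \<and>
     (\<forall>c x y. csc c (x + y) = csc c x + csc c y) \<and>
     (\<forall>r x. csc (complex_of_real r) x = r *\<^sub>R x) \<and>
     (\<forall>c x y. csc c (x * y) = csc c x * y \<and> csc c (x * y) = x * csc c y) \<and>
     (\<forall>c x. norm (csc c x) = cmod c * norm x) \<and>
     (\<forall>x. star (star x) = x) \<and>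
     (\<forall>x y. star (x + y) = star x + star y) \<and>
     (\<forall>c x. star (csc c x) = csc (cnj c) (star x)) \<and>
     (\<forall>x y. star (x * y) = star y * star x) \<and>
     (\<forall>x. norm (star x * x) = (norm x)\<^sup>2)"

subsection \<open>The unitization \<open>A~ = A \<oplus> \<complex>\<close> (pairs (a, \<lambda>) standing for a + \<lambda>1)\<close>

definition umult :: "(complex \<Rightarrow> 'a::ring \<Rightarrow> 'a) \<Rightarrow> 'a \<times> complex \<Rightarrow> 'a \<times> complex \<Rightarrow> 'a \<times> complex" where
  "umult csc x y = (fst x * fst y + csc (snd x) (fst y) + csc (snd y) (fst x), snd x * snd y)"

definition ustar :: "('a \<Rightarrow> 'a) \<Rightarrow> 'a \<times> complex \<Rightarrow> 'a \<times> complex" where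
  "ustar star x = (star (fst x), cnj (snd x))"

definition uinvertible :: "(complex \<Rightarrow> 'a::ring \<Rightarrow> 'a) \<Rightarrow> 'a \<times> complex \<Rightarrow> bool" where
  "uinvertible csc x \<longleftrightarrow> (\<exists>w. umult csc x w = (0, 1) \<and> umult csc w x = (0, 1))"

definition uspectrum :: "(complex \<Rightarrow> 'a::ring \<Rightarrow> 'a) \<Rightarrow> 'a \<Rightarrow> complex set" where
  "uspectrum csc a = {z. \<not> uinvertible csc (a, - z)}"

definition real_rank_zero :: "(complex \<Rightarrow> 'a::{real_normed_algebra,banach} \<Rightarrow> 'a) \<Rightarrow> ('a \<Rightarrow> 'a) \<Rightarrow> bool" where
  "real_rank_zero csc star \<longleftrightarrow>
     (\<forall>x. star x = x \<longrightarrow> (\<forall>\<epsilon>>0. \<exists>y. star y = y \<and> finite (uspectrum csc y) \<and> norm (x - y) < \<epsilon>))"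

text \<open>An element of M_n(A~) is a function nat => nat => A~ vanishing outside {..<n} x {..<n}.\<close>

definition msupp :: "nat \<Rightarrow> (nat \<Rightarrow> nat \<Rightarrow> 'a::zero \<times> complex) \<Rightarrow> bool" where
  "msupp n M \<longleftrightarrow> (\<forall>i j. n \<le> i \<or> n \<le> j \<longrightarrow> M i j = (0, 0))"

definition in_A :: "(nat \<Rightarrow> nat \<Rightarrow> 'a \<times> complex) \<Rightarrow> bool" where
  "in_A M \<longleftrightarrow> (\<forall>i j. snd (M i j) = 0)"

definition mmul :: "(complex \<Rightarrow> 'a::ring \<Rightarrow> 'a) \<Rightarrow> nat \<Rightarrow> (nat \<Rightarrow> nat \<Rightarrow> 'a \<times> complex)
    \<Rightarrow> (nat \<Rightarrow> nat \<Rightarrow> 'a \<times> complex) \<Rightarrow> nat \<Rightarrow> nat \<Rightarrow> 'a \<times> complex" where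
  "mmul csc n M N i j = (\<Sum>k<n. umult csc (M i k) (N k j))"

definition mstar :: "('a \<Rightarrow> 'a) \<Rightarrow> (nat \<Rightarrow> nat \<Rightarrow> 'a \<times> complex) \<Rightarrow> nat \<Rightarrow> nat \<Rightarrow> 'a \<times> complex" where
  "mstar star M i j = ustar star (M j i)"

definition is_uproj :: "(complex \<Rightarrow> 'a::ring \<Rightarrow> 'a) \<Rightarrow> ('a \<Rightarrow> 'a) \<Rightarrow> nat \<Rightarrow> (nat \<Rightarrow> nat \<Rightarrow> 'a \<times> complex) \<Rightarrow> bool" where
  "is_uproj csc star n P \<longleftrightarrow> msupp n P \<and> mstar star P = P \<and> mmul csc n P P = P"

definition is_proj :: "(complex \<Rightarrow> 'a::ring \<Rightarrow> 'a) \<Rightarrow> ('a \<Rightarrow> 'a) \<Rightarrow> nat \<Rightarrow> (nat \<Rightarrow> nat \<Rightarrow> 'a \<times> complex) \<Rightarrow> bool" where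
  "is_proj csc star n P \<longleftrightarrow> is_uproj csc star n P \<and> in_A P"

text \<open>Murray--von Neumann equivalence of P in M_n and Q in M_m, via a partial isometry
  (padded with zeros to a square matrix of size N), over A~ resp. over A.\<close>
definition mvn_u :: "(complex \<Rightarrow> 'a::ring \<Rightarrow> 'a) \<Rightarrow> ('a \<Rightarrow> 'a) \<Rightarrow> nat \<Rightarrow> (nat \<Rightarrow> nat \<Rightarrow> 'a \<times> complex)
    \<Rightarrow> nat \<Rightarrow> (nat \<Rightarrow> nat \<Rightarrow> 'a \<times> complex) \<Rightarrow> bool" where
  "mvn_u csc star n P m Q \<longleftrightarrow> (\<exists>N V. n \<le> N \<and> m \<le> N \<and> msupp N V \<and>
      mmul csc N (mstar star V) V = P \<and> mmul csc N V (mstar star V) = Q)"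

definition mvn_A :: "(complex \<Rightarrow> 'a::ring \<Rightarrow> 'a) \<Rightarrow> ('a \<Rightarrow> 'a) \<Rightarrow> nat \<Rightarrow> (nat \<Rightarrow> nat \<Rightarrow> 'a \<times> complex)
    \<Rightarrow> nat \<Rightarrow> (nat \<Rightarrow> nat \<Rightarrow> 'a \<times> complex) \<Rightarrow> bool" where
  "mvn_A csc star n P m Q \<longleftrightarrow> (\<exists>N V. n \<le> N \<and> m \<le> N \<and> msupp N V \<and> in_A V \<and>
      mmul csc N (mstar star V) V = P \<and> mmul csc N V (mstar star V) = Q)"

definition dsum :: "nat \<Rightarrow> (nat \<Rightarrow> nat \<Rightarrow> 'a::zero \<times> complex) \<Rightarrow> nat \<Rightarrow> (nat \<Rightarrow> nat \<Rightarrow> 'a \<times> complex)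
    \<Rightarrow> nat \<Rightarrow> nat \<Rightarrow> 'a \<times> complex" where
  "dsum n P m Q i j =
     (if i < n \<and> j < n then P i j
      else if n \<le> i \<and> n \<le> j then Q (i - n) (j - n) else (0, 0))"

definition uunit :: "nat \<Rightarrow> nat \<Rightarrow> nat \<Rightarrow> 'a::zero \<times> complex" where
  "uunit k i j = (if i = j \<and> i < k then (0, 1) else (0, 0))"

text \<open>[P]_0 = [Q]_0 in K_0(A) (= ker(K_0(A~) -> K_0(C)), so equality in K_0(A~)):
  P (+) 1_k ~ Q (+) 1_k in M_\<infinity>(A~) for some k.\<close>
definition k0_eq :: "(complex \<Rightarrow> 'a::ring \<Rightarrow> 'a) \<Rightarrow> ('a \<Rightarrow> 'a) \<Rightarrow> nat \<Rightarrow> (nat \<Rightarrow> nat \<Rightarrow> 'a \<times> complex)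
    \<Rightarrow> nat \<Rightarrow> (nat \<Rightarrow> nat \<Rightarrow> 'a \<times> complex) \<Rightarrow> bool" where
  "k0_eq csc star n P m Q \<longleftrightarrow>
     (\<exists>k. mvn_u csc star (n + k) (dsum n P k (uunit k)) (m + k) (dsum m Q k (uunit k)))"

text \<open>[P]_0 \<le> [R]_0, i.e. [R]_0 - [P]_0 \<in> K_0(A)^+ = {[Q]_0 | Q \<in> P_\<infinity>(A)}.\<close>
definition k0_le :: "(complex \<Rightarrow> 'a::ring \<Rightarrow> 'a) \<Rightarrow> ('a \<Rightarrow> 'a) \<Rightarrow> nat \<Rightarrow> (nat \<Rightarrow> nat \<Rightarrow> 'a \<times> complex)
    \<Rightarrow> nat \<Rightarrow> (nat \<Rightarrow> nat \<Rightarrow> 'a \<times> complex) \<Rightarrow> bool" where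
  "k0_le csc star n P m R \<longleftrightarrow>
     (\<exists>l Q. is_proj csc star l Q \<and> k0_eq csc star (n + l) (dsum n P l Q) m R)"

definition has_cancellation :: "(complex \<Rightarrow> 'a::ring \<Rightarrow> 'a) \<Rightarrow> ('a \<Rightarrow> 'a) \<Rightarrow> bool" where
  "has_cancellation csc star \<longleftrightarrow>
     (\<forall>n P m Q. is_proj csc star n P \<longrightarrow> is_proj csc star m Q \<longrightarrow>
        (k0_eq csc star n P m Q \<longleftrightarrow> mvn_A csc star n P m Q))"

definition proj :: "('a \<Rightarrow> 'a) \<Rightarrow> 'a::ring \<Rightarrow> bool" where
  "proj star p \<longleftrightarrow> star p = p \<and> p * p = p"

definition mat1 :: "'a::zero \<Rightarrow> nat \<Rightarrow> nat \<Rightarrow> 'a \<times> complex" where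
  "mat1 p i j = (if i = 0 \<and> j = 0 then (p, 0) else (0, 0))"

definition k0pos_eq_D0 :: "(complex \<Rightarrow> 'a::ring \<Rightarrow> 'a) \<Rightarrow> ('a \<Rightarrow> 'a) \<Rightarrow> bool" where
  "k0pos_eq_D0 csc star \<longleftrightarrow>
     (\<forall>m R. is_proj csc star m R \<longrightarrow> (\<exists>p. proj star p \<and> k0_eq csc star m R 1 (mat1 p)))"

text \<open>Singular value function: s_g(a) for g = [R]_0, R \<in> M_m(A) a projection.\<close>
definition sval :: "(complex \<Rightarrow> 'a::{real_normed_algebra} \<Rightarrow> 'a) \<Rightarrow> ('a \<Rightarrow> 'a) \<Rightarrow> nat \<Rightarrow> (nat \<Rightarrow> nat \<Rightarrow> 'a \<times> complex)
    \<Rightarrow> 'a \<Rightarrow> real" where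
  "sval csc star m R a = Inf {norm (a - a * p) | p. proj star p \<and> k0_le csc star 1 (mat1 p) m R}"

end

theory Submission
  imports Defs "HOL-Computational_Algebra.Computational_Algebra"
begin

text \<open>
  Let \<open>p\<close>, \<open>q\<close> be projections competing in \<open>s\<^sub>g(a)\<close>, \<open>s\<^sub>h(b)\<close> and put \<open>c = p b (1 - q)\<close>. Then
  \<open>a b = a (1 - p) b (1 - q) + a c + a b q\<close>, so it suffices to find a projection \<open>r\<close> with
  \<open>[r] \<le> g + h\<close> for which \<open>c (1 - r)\<close> and \<open>q (1 - r)\<close> are small. By real rank zero the element
  \<open>z = c\<^sup>* c + q\<close> is close to some \<open>\<Sum> l e\<^sub>l\<close> with real \<open>l\<close> and orthogonal projections \<open>e\<^sub>l\<close>; take for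
  \<open>r\<close> the sum of the \<open>e\<^sub>l\<close> with \<open>l\<close> not too small. Since \<open>z\<close> is positive, no \<open>l\<close> is very
  negative, which makes \<open>z (1 - r)\<close> small, and \<open>c\<^sup>* c\<close> and \<open>q\<close> are orthogonal. Moreover \<open>r z r\<close> is
  invertible in \<open>r A r\<close>, so \<open>r = t\<^sup>* z t\<close> for some \<open>t\<close>: the column \<open>(c t, q t)\<close> is a partial isometry
  from \<open>r\<close> into \<open>p \<oplus> q\<close>. Cancellation turns the inequalities in \<open>K\<^sub>0\<close> into Murray--von Neumann
  subequivalences over \<open>A\<close>, and back.
\<close>

section \<open>Projections and their orthogonal combinations\<close>

locale cstar =
  fixes csc :: "complex \<Rightarrow> 'a::{real_normed_algebra,banach} \<Rightarrow> 'a"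
    and star :: "'a \<Rightarrow> 'a"
  assumes cstar_algebra: "cstar_algebra csc star"
begin

lemma csc_one: "csc 1 x = x"
  and csc_mult: "csc (c * d) x = csc c (csc d x)"
  and csc_add_left: "csc (c + d) x = csc c x + csc d x"
  and csc_add_right: "csc c (x + y) = csc c x + csc c y"
  and csc_of_real: "csc (complex_of_real r) x = r *\<^sub>R x"
  and csc_mult_left: "csc c x * y = csc c (x * y)"
  and csc_mult_right: "x * csc c y = csc c (x * y)"
  and norm_csc: "norm (csc c x) = cmod c * norm x"
  and star_star: "star (star x) = x"
  and star_add: "star (x + y) = star x + star y"
  and star_csc: "star (csc c x) = csc (cnj c) (star x)"
  and star_mult: "star (x * y) = star y * star x"
  and norm_star_mult_self: "norm (star x * x) = (norm x)\<^sup>2"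
  using cstar_algebra unfolding cstar_algebra_def by metis+

lemma csc_zero_left: "csc 0 x = 0"
  using norm_csc[of 0 x] by simp

lemma csc_zero_right: "csc c 0 = 0"
  using norm_csc[of c 0] by simp

lemma csc_minus_left: "csc (- c) x = - csc c x"
  using csc_add_left[of c "- c" x] by (simp add: csc_zero_left eq_neg_iff_add_eq_0 add.commute)

lemma csc_diff_left: "csc (c - d) x = csc c x - csc d x"
  using csc_add_left[of c "- d" x] by (simp add: csc_minus_left)

lemma csc_minus_right: "csc c (- x) = - csc c x"
  using csc_add_right[of c x "- x"] by (simp add: csc_zero_right eq_neg_iff_add_eq_0 add.commute)

lemma csc_diff_right: "csc c (x - y) = csc c x - csc c y"
  using csc_add_right[of c x "- y"] by (simp add: csc_minus_right)

lemma csc_scaleR: "csc c (r *\<^sub>R x) = r *\<^sub>R csc c x"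
  by (simp add: mult.commute flip: csc_of_real csc_mult)

lemma star_zero: "star 0 = 0"
  using star_add[of 0 0] by simp

lemma star_scaleR: "star (r *\<^sub>R x) = r *\<^sub>R star x"
  using star_csc[of "complex_of_real r" x] by (simp add: csc_of_real)

lemma star_minus: "star (- x) = - star x"
  using star_scaleR[of "-1" x] by simp

lemma star_diff: "star (x - y) = star x - star y"
  using star_add[of x "- y"] by (simp add: star_minus)

lemma star_sum: "star (sum f F) = (\<Sum>i\<in>F. star (f i))"
  by (induction F rule: infinite_finite_induct) (simp_all add: star_zero star_add)

lemma norm_star: "norm (star x) = norm x"
proof -
  have le: "norm y \<le> norm (star y)" for y
  proof (cases "y = 0")
    case False
    have "norm y * norm y \<le> norm (star y) * norm y"
      using norm_mult_ineq[of "star y" y] norm_star_mult_self[of y] by (simp add: power2_eq_square)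
    then show ?thesis using False by simp
  qed simp
  from le[of x] le[of "star x"] show ?thesis by (simp add: star_star)
qed

lemma norm_mult_star_self: "norm (x * star x) = (norm x)\<^sup>2"
  using norm_star_mult_self[of "star x"] by (simp add: star_star norm_star)

lemma star_mult_self_eq_0: "star x * x = 0 \<longleftrightarrow> x = 0"
  using norm_star_mult_self[of x] by auto

lemma bounded_linear_star: "bounded_linear star"
  by (rule bounded_linear_intro[where K = 1]) (simp_all add: star_add star_scaleR norm_star)

lemma projD: "proj star p \<Longrightarrow> star p = p" "proj star p \<Longrightarrow> p * p = p"
  by (simp_all add: proj_def)

lemma proj_mult_cancel: "proj star p \<Longrightarrow> p * (p * x) = p * x"
  by (metis projD(2) mult.assoc)

lemma norm_proj: "proj star p \<Longrightarrow> p \<noteq> 0 \<Longrightarrow> norm p = 1"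
  using norm_star_mult_self[of p] by (simp add: projD power2_eq_square)

lemma norm_proj_le: "proj star p \<Longrightarrow> norm p \<le> 1"
  using norm_proj[of p] by (cases "p = 0") auto

text \<open>\<open>1 - 2 e\<close> is a self-adjoint unitary, so left multiplication by it is
  isometric. Only its action on \<open>y\<close> is mentioned, since the algebra need not have a
  unit.\<close>

lemma norm_symmetry_mult:
  assumes "proj star e"
  shows "norm (y - 2 *\<^sub>R (e * y)) = norm y"
proof -
  have "star (y - 2 *\<^sub>R (e * y)) * (y - 2 *\<^sub>R (e * y)) = star y * y"
    using projD[OF assms] proj_mult_cancel[OF assms]
    by (simp add: star_diff star_add star_scaleR star_mult algebra_simps scaleR_2)
  then have "(norm (y - 2 *\<^sub>R (e * y)))\<^sup>2 = (norm y)\<^sup>2"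
    by (metis norm_star_mult_self)
  then show ?thesis by simp
qed

text \<open>\<open>1 - (1 - l) e\<close> is the convex combination of \<open>1\<close> and the
  symmetry \<open>1 - 2 e\<close> with weights \<open>(1 + l) / 2\<close> and
  \<open>(1 - l) / 2\<close>, hence a contraction. It acts as \<open>l\<close> on the range of
  \<open>e\<close> and as the identity on the complement.\<close>

lemma norm_proj_contraction:
  assumes e: "proj star e" and L: "\<bar>l\<bar> \<le> 1"
  shows "norm (y - (1 - l) *\<^sub>R (e * y)) \<le> norm y"
proof -
  have "y - (1 - l) *\<^sub>R (e * y) = ((1 + l) / 2) *\<^sub>R y + ((1 - l) / 2) *\<^sub>R (y - 2 *\<^sub>R (e * y))"
    by (simp add: algebra_simps flip: scaleR_add_left)
       (simp add: field_simps flip: scaleR_add_left)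
  also have "norm \<dots> \<le> ((1 + l) / 2) * norm y + ((1 - l) / 2) * norm y"
    using L by (intro order_trans[OF norm_triangle_ineq]) (simp add: norm_symmetry_mult[OF e])
  also have "\<dots> = norm y" by (simp add: field_simps)
  finally show ?thesis .
qed

lemma norm_diff_proj_right:
  assumes "proj star e"
  shows "norm (x - x * e) \<le> norm x"
proof -
  have "norm (star x - e * star x) \<le> norm (star x)"
    using norm_proj_contraction[OF assms, of 0 "star x"] by simp
  then have "norm (star (star x - e * star x)) \<le> norm (star x)"
    by (simp only: norm_star)
  then show ?thesis
    using projD[OF assms] by (simp add: star_diff star_mult star_star norm_star)
qed

lemma norm_diff_proj_left: "proj star e \<Longrightarrow> norm (x - e * x) \<le> norm x"
  using norm_proj_contraction[of e 0 x] by simp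

section \<open>Finite orthogonal families of projections\<close>

definition orth_proj_family :: "'i set \<Rightarrow> ('i \<Rightarrow> 'a) \<Rightarrow> bool" where
  "orth_proj_family F e \<longleftrightarrow> finite F \<and> (\<forall>i\<in>F. proj star (e i)) \<and>
     (\<forall>i\<in>F. \<forall>j\<in>F. i \<noteq> j \<longrightarrow> e i * e j = 0)"

lemma orth_proj_family_subset:
  "orth_proj_family F e \<Longrightarrow> G \<subseteq> F \<Longrightarrow> orth_proj_family G e"
  unfolding orth_proj_family_def by (meson finite_subset subsetD)

lemma orth_mult:
  assumes "orth_proj_family F e"
  shows "(\<Sum>i\<in>F. l i *\<^sub>R e i) * (\<Sum>i\<in>F. m i *\<^sub>R e i) = (\<Sum>i\<in>F. (l i * m i) *\<^sub>R e i)"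
proof -
  have fin: "finite F" using assms by (simp add: orth_proj_family_def)
  have "(\<Sum>i\<in>F. l i *\<^sub>R e i) * (\<Sum>i\<in>F. m i *\<^sub>R e i)
      = (\<Sum>i\<in>F. \<Sum>j\<in>F. (l i *\<^sub>R e i) * (m j *\<^sub>R e j))"
    by (simp add: sum_product)
  also have "\<dots> = (\<Sum>i\<in>F. \<Sum>j\<in>F. if j = i then (l i * m i) *\<^sub>R e i else 0)"
    using assms by (intro sum.cong refl) (auto simp: orth_proj_family_def proj_def)
  also have "\<dots> = (\<Sum>i\<in>F. (l i * m i) *\<^sub>R e i)"
    using fin by simp
  finally show ?thesis .
qed

lemma star_orth_sum:
  assumes "orth_proj_family F e"
  shows "star (\<Sum>i\<in>F. l i *\<^sub>R e i) = (\<Sum>i\<in>F. l i *\<^sub>R e i)"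
  using assms by (simp add: star_sum star_scaleR orth_proj_family_def proj_def)

lemma orth_mult_single:
  assumes "orth_proj_family F e" "j \<in> F"
  shows "(\<Sum>i\<in>F. l i *\<^sub>R e i) * e j = l j *\<^sub>R e j"
proof -
  have "(\<Sum>i\<in>F. l i *\<^sub>R e i) * e j = (\<Sum>i\<in>F. if i = j then l j *\<^sub>R e j else 0)"
    unfolding sum_distrib_right
    using assms by (intro sum.cong refl) (auto simp: orth_proj_family_def proj_def)
  then show ?thesis using assms by (simp add: orth_proj_family_def)
qed

text \<open>The operator applied to \<open>y\<close> is \<open>l i\<close> on \<open>e i\<close> and
  \<open>L\<close> on the complement of the family. It equals \<open>L\<close> times the product of
  the commuting contractions \<open>1 - (1 - l i / L) e i\<close>, which the induction peels off one
  by one.\<close>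

lemma norm_orth_combination:
  assumes "orth_proj_family F e" and "L > 0" and "\<And>i. i \<in> F \<Longrightarrow> \<bar>l i\<bar> \<le> L"
  shows "norm (L *\<^sub>R y - (\<Sum>i\<in>F. (L - l i) *\<^sub>R (e i * y))) \<le> L * norm y"
proof -
  have "finite F" using assms(1) by (simp add: orth_proj_family_def)
  then show ?thesis using assms
  proof (induction F arbitrary: y rule: finite_induct)
    case (insert j F)
    have fam: "orth_proj_family F e" using insert.prems(1) by (rule orth_proj_family_subset) auto
    have ej: "proj star (e j)" using insert.prems(1) by (simp add: orth_proj_family_def)
    have orth: "e i * (e j * y) = 0" if "i \<in> F" for i
    proof -
      have "e i * e j = 0"
        using insert.prems(1) insert.hyps(2) that by (auto simp: orth_proj_family_def)
      then show ?thesis by (simp flip: mult.assoc)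
    qed
    define y' where "y' = y - (1 - l j / L) *\<^sub>R (e j * y)"
    have y': "norm y' \<le> norm y"
      unfolding y'_def using insert.prems(2,3) ej
      by (intro norm_proj_contraction) (auto simp: field_simps abs_le_iff)
    have "e i * y' = e i * y" if "i \<in> F" for i
      using orth[OF that] by (simp add: y'_def algebra_simps)
    then have "L *\<^sub>R y - (\<Sum>i\<in>insert j F. (L - l i) *\<^sub>R (e i * y))
        = L *\<^sub>R y' - (\<Sum>i\<in>F. (L - l i) *\<^sub>R (e i * y'))"
      using insert.hyps insert.prems(2) by (simp add: y'_def algebra_simps)
    then show ?case
      using insert.IH[OF fam insert.prems(2,3), of y'] y' insert.prems(2)
      by (smt (verit, best) insertCI mult_le_cancel_left_pos)
  qed simp
qed

text \<open>Subtracting the combinations for \<open>l\<close> and for \<open>- l\<close> removes the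
  part outside the family and leaves \<open>2 x y\<close>. In place of a unit, the element tested is
  \<open>y = star x\<close>, and the C*-identity turns the result into a bound for
  \<open>x\<close>.\<close>

lemma norm_orth_sum_le:
  assumes fam: "orth_proj_family F e" and L: "L > 0" and l: "\<And>i. i \<in> F \<Longrightarrow> \<bar>l i\<bar> \<le> L"
  shows "norm (\<Sum>i\<in>F. l i *\<^sub>R e i) \<le> L"
proof -
  define x where "x = (\<Sum>i\<in>F. l i *\<^sub>R e i)"
  define y where "y = star x"
  define a where "a = L *\<^sub>R y - (\<Sum>i\<in>F. (L - l i) *\<^sub>R (e i * y))"
  define b where "b = L *\<^sub>R y - (\<Sum>i\<in>F. (L - (- l i)) *\<^sub>R (e i * y))"
  have "norm a \<le> L * norm y" unfolding a_def by (rule norm_orth_combination[OF fam L l])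
  moreover have "norm b \<le> L * norm y"
    unfolding b_def by (rule norm_orth_combination[OF fam L]) (simp add: l)
  moreover have "a - b = 2 *\<^sub>R (x * y)"
    by (simp add: a_def b_def x_def sum_distrib_right algebra_simps sum.distrib sum_subtractf scaleR_2)
  ultimately have "2 * norm (x * y) \<le> 2 * (L * norm y)"
    using norm_triangle_ineq4[of a b] by simp
  then have "norm x * norm x \<le> L * norm x"
    using norm_mult_star_self[of x] by (simp add: y_def norm_star power2_eq_square)
  then show ?thesis
    using L unfolding x_def[symmetric] by (cases "x = 0") auto
qed

lemma norm_orth_sum_ge:
  assumes "orth_proj_family F e" "j \<in> F" "e j \<noteq> 0"
  shows "\<bar>l j\<bar> \<le> norm (\<Sum>i\<in>F. l i *\<^sub>R e i)"
proof -
  have "norm (e j) = 1" using assms norm_proj by (auto simp: orth_proj_family_def)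
  then show ?thesis
    using norm_mult_ineq[of "\<Sum>i\<in>F. l i *\<^sub>R e i" "e j"] orth_mult_single[OF assms(1,2), of l]
    by simp
qed

end

section \<open>Square roots and quasi-inverses\<close>

text \<open>These are the Taylor coefficients of \<open>1 + x\<close> to the power
  \<open>- 1 / 2\<close>. The ratio of consecutive ones has modulus at most 1, so a geometric series
  dominates the binomial series.\<close>

lemma abs_gbinomial_minus_half_le: "\<bar>(- 1 / 2 :: real) gchoose n\<bar> \<le> 1"
proof (induction n)
  case (Suc n)
  have rec: "(- 1 / 2 :: real) gchoose Suc n = ((- 1 / 2 - real n) / real (Suc n)) * ((- 1 / 2) gchoose n)"
    using gbinomial_mult_1[of "- 1 / 2 :: real" n] by (simp add: field_simps)
  have "\<bar>(- 1 / 2 - real n) / real (Suc n)\<bar> \<le> 1" by (simp add: field_simps abs_le_iff)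
  then show ?case unfolding rec abs_mult using Suc by (intro mult_le_one) auto
qed simp

context cstar
begin

text \<open>In the corner with unit \<open>r\<close>, the binomial series for the inverse square
  root of \<open>r + s\<close> converges because \<open>norm s < 1\<close>.\<close>

lemma corner_inverse_sqrt:
  assumes r: "proj star r" and s: "star s = s" "r * s = s" "norm s < 1"
  shows "\<exists>w. star w = w \<and> w * r = w \<and> r * w = w \<and> w * (r + s) * w = r"
proof -
  \<comment> \<open>Powers of \<open>s\<close> in the corner: the zeroth power is
    \<open>r\<close>.\<close>
  define sp where "sp n = (((*) s) ^^ n) r" for n
  define c where "c n = ((- 1 / 2 :: real) gchoose n)" for n
  have sr: "s * r = s" using arg_cong[OF s(2), of star] by (simp add: star_mult s(1) projD[OF r])
  have sp0: "sp 0 = r" and spS: "sp (Suc n) = s * sp n" for n by (simp_all add: sp_def)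
  have r_sp: "r * sp n = sp n" for n
    by (cases n) (simp_all add: sp0 spS projD[OF r] s(2) flip: mult.assoc)
  have sp_add: "sp m * sp n = sp (m + n)" for m n
    by (induction m) (simp_all add: sp0 spS r_sp mult.assoc)
  have sp1: "sp (Suc 0) = s" by (simp add: spS sp0 sr)
  have sp_s: "sp n * s = sp (Suc n)" for n using sp_add[of n "Suc 0"] by (simp add: sp1)
  have sp_r: "sp n * r = sp n" for n using sp_add[of n 0] by (simp add: sp0)
  have star_sp: "star (sp n) = sp n" for n
  proof (induction n)
    case (Suc n)
    have "star (sp (Suc n)) = sp n * s" by (simp only: spS star_mult s(1) Suc)
    then show ?case by (simp only: sp_s)
  qed (simp add: sp0 projD[OF r])
  have norm_sp: "norm (sp n) \<le> norm s ^ n" for n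
  proof (induction n)
    case (Suc n)
    have "norm (sp (Suc n)) \<le> norm s * norm (sp n)" unfolding spS by (rule norm_mult_ineq)
    also have "\<dots> \<le> norm s * norm s ^ n" using Suc by (intro mult_left_mono) auto
    finally show ?case by simp
  qed (simp add: sp0 norm_proj_le[OF r])
  have geo: "summable (\<lambda>n. norm s ^ n)" using s(3) by simp
  have bnd: "norm (d *\<^sub>R sp n) \<le> norm s ^ n" if "\<bar>d\<bar> \<le> 1" for d n
    using mult_mono[OF that norm_sp[of n]] by simp
  have sumn: "summable (\<lambda>n. norm (d n *\<^sub>R sp n))" if "\<And>n. \<bar>d n\<bar> \<le> 1" for d :: "nat \<Rightarrow> real"
    by (rule summable_norm_comparison_test[OF _ geo]) (use bnd that in blast)
  have c1: "\<bar>c n\<bar> \<le> 1" for n unfolding c_def by (rule abs_gbinomial_minus_half_le)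
  define w where "w = (\<Sum>n. c n *\<^sub>R sp n)"
  have sc: "summable (\<lambda>n. c n *\<^sub>R sp n)" using sumn[of c] c1 by (blast intro: summable_norm_cancel)
  \<comment> \<open>Chu-Vandermonde: the coefficients convolved with themselves are those of
    \<open>1 / (1 + x)\<close>, so \<open>w * w\<close> is the Neumann series for the inverse of
    \<open>r + s\<close>.\<close>
  have conv: "(\<Sum>i\<le>k. c i * c (k - i)) = (-1) ^ k" for k
  proof -
    have "(\<Sum>i\<le>k. c i * c (k - i)) = (-1 :: real) gchoose k"
      using gbinomial_Vandermonde[of "-1/2 :: real" "-1/2" k] by (simp add: c_def atMost_atLeast0)
    also have "\<dots> = (-1) ^ k * ((1 + real k - 1) gchoose k)"
      by (rule gbinomial_minus)
    also have "\<dots> = (-1) ^ k" using binomial_gbinomial[of k k, where 'a = real] by simp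
    finally show ?thesis .
  qed
  have ww: "w * w = (\<Sum>k. (-1) ^ k *\<^sub>R sp k)"
  proof -
    have "(\<Sum>i\<le>k. (c i *\<^sub>R sp i) * (c (k - i) *\<^sub>R sp (k - i))) = (-1) ^ k *\<^sub>R sp k" for k
    proof -
      have "(\<Sum>i\<le>k. (c i *\<^sub>R sp i) * (c (k - i) *\<^sub>R sp (k - i))) = (\<Sum>i\<le>k. (c i * c (k - i)) *\<^sub>R sp k)"
        by (intro sum.cong refl) (simp add: sp_add)
      then show ?thesis by (simp add: conv flip: scaleR_sum_left)
    qed
    then show ?thesis unfolding w_def using Cauchy_product[OF sumn[of c] sumn[of c]] c1 by simp
  qed
  have s1: "summable (\<lambda>k. (-1) ^ k *\<^sub>R sp k)"
    by (rule summable_norm_cancel, rule sumn) (simp add: power_abs)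
  have inv: "(r + s) * (w * w) = r"
  proof -
    have "(r + s) * (w * w) = (\<Sum>k. (r + s) * ((-1) ^ k *\<^sub>R sp k))"
      unfolding ww using s1 by (rule suminf_mult[symmetric])
    also have "(\<lambda>k. (r + s) * ((-1) ^ k *\<^sub>R sp k)) = (\<lambda>k. (-1) ^ k *\<^sub>R sp k - (-1) ^ Suc k *\<^sub>R sp (Suc k))"
      by (simp add: distrib_right scaleR_add_right r_sp spS)
    also have "\<dots> sums ((-1) ^ 0 *\<^sub>R sp 0 - 0)"
      by (rule telescope_sums') (rule summable_LIMSEQ_zero[OF s1])
    then have "(\<Sum>k. (-1) ^ k *\<^sub>R sp k - (-1) ^ Suc k *\<^sub>R sp (Suc k)) = r"
      by (simp add: sums_iff sp0)
    finally show ?thesis .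
  qed
  have "star w = w"
    unfolding w_def bounded_linear.suminf[OF bounded_linear_star sc] by (simp add: star_scaleR star_sp)
  moreover have wr: "w * r = w"
    unfolding w_def suminf_mult2[OF sc] by (simp add: sp_r)
  moreover have rw: "r * w = w"
    unfolding w_def suminf_mult[OF sc, symmetric] by (simp add: r_sp)
  moreover have "w * s = s * w"
    unfolding w_def suminf_mult[OF sc, symmetric] suminf_mult2[OF sc] by (simp add: sp_s spS)
  then have "w * (r + s) = (r + s) * w"
    by (simp add: distrib_left distrib_right wr rw)
  then have "w * (r + s) * w = r"
    using inv by (simp only: mult.assoc)
  ultimately show ?thesis by blast
qed

text \<open>Passing from \<open>k\<close> to \<open>k * k\<close> averages the quasi-inverses of \<open>z k\<close> and \<open>- z k\<close>, so their
  variation between the radii \<open>s\<close> and \<open>1\<close> does not grow while \<open>s\<close> is squared. After enough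
  squarings the inner quasi-inverse is nearly \<open>0\<close>, which would force \<open>k\<close> to have norm below 1.\<close>

lemma quasi_inverse_doubling:
  assumes a: "a = csc z k + csc z (k * a)" and b: "b = csc (- z) k + csc (- z) (k * b)"
  shows "(1 / 2) *\<^sub>R (a + b) = csc (z * z) (k * k) + csc (z * z) (k * k * ((1 / 2) *\<^sub>R (a + b)))"
proof -
  have twice: "x = csc y k + csc (y * y) (k * k) + csc (y * y) (k * k * x)"
    if x: "x = csc y k + csc y (k * x)" for x y
  proof -
    have "csc y (k * x) = csc y (k * (csc y k + csc y (k * x)))"
      using arg_cong[OF x, of "\<lambda>u. csc y (k * u)"] .
    then have "csc y (k * x) = csc (y * y) (k * k) + csc (y * y) (k * k * x)"
      by (simp add: distrib_left csc_add_right csc_mult_right csc_mult mult.assoc)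
    then show ?thesis using x by (simp add: add.assoc)
  qed
  have a2: "a = csc z k + csc (z * z) (k * k) + csc (z * z) (k * k * a)" by (rule twice[OF a])
  have b2: "b = - csc z k + csc (z * z) (k * k) + csc (z * z) (k * k * b)"
    using twice[OF b] by (simp add: csc_minus_left)
  have "a + b = 2 *\<^sub>R csc (z * z) (k * k) + csc (z * z) (k * k * (a + b))"
    by (subst a2, subst b2) (simp add: distrib_left csc_add_right scaleR_2)
  then have "(1 / 2) *\<^sub>R (a + b) = (1 / 2) *\<^sub>R (2 *\<^sub>R csc (z * z) (k * k) + csc (z * z) (k * k * (a + b)))"
    by simp
  also have "\<dots> = csc (z * z) (k * k) + csc (z * z) (k * k * ((1 / 2) *\<^sub>R (a + b)))"
    by (simp add: scaleR_add_right distrib_left csc_add_right csc_scaleR)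
  finally show ?thesis .
qed

lemma no_uniform_quasi_inverse:
  fixes s :: real
  assumes k: "star k = k" "norm k = 1" and s: "0 \<le> s" "s < 1"
    and qi: "\<And>z. cmod z = 1 \<Longrightarrow> \<exists>a b. a = csc z k + csc z (k * a) \<and>
      b = csc (complex_of_real s * z) k + csc (complex_of_real s * z) (k * b) \<and> norm (a - b) \<le> 1 / 4"
  shows False
proof -
  \<comment> \<open>The witness for \<open>m\<close> is the original element to the power
    \<open>2 ^ m\<close>; self-adjointness keeps its norm equal to 1.\<close>
  have it: "\<exists>k. star k = k \<and> norm k = 1 \<and> (\<forall>z. cmod z = 1 \<longrightarrow> (\<exists>a b. a = csc z k + csc z (k * a) \<and>
      b = csc (complex_of_real (s ^ (2 ^ m)) * z) k + csc (complex_of_real (s ^ (2 ^ m)) * z) (k * b) \<and> norm (a - b) \<le> 1 / 4))" for m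
  proof (induction m)
    case 0
    show ?case using k qi by auto
  next
    case (Suc m)
    define t where "t = complex_of_real (s ^ (2 ^ m))"
    have tt: "complex_of_real (s ^ (2 ^ Suc m)) = t * t"
      by (simp add: t_def power_mult power2_eq_square mult.commute[of 2] del: of_real_power)
    from Suc[folded t_def] obtain k where k: "star k = k" "norm k = 1"
      and qi: "\<And>z. cmod z = 1 \<Longrightarrow> \<exists>a b. a = csc z k + csc z (k * a) \<and>
        b = csc (t * z) k + csc (t * z) (k * b) \<and> norm (a - b) \<le> 1 / 4" by blast
    show ?case
    proof (rule exI[of _ "k * k"], intro conjI allI impI)
      show "star (k * k) = k * k" by (simp add: star_mult k)
      show "norm (k * k) = 1" using norm_star_mult_self[of k] by (simp add: k)
      fix z :: complex assume z: "cmod z = 1"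
      \<comment> \<open>Doubling at \<open>x\<close> and \<open>- x\<close>, the two square roots of
        \<open>z\<close>, yields quasi-inverses for \<open>k * k\<close> at \<open>z\<close>;
        averaging keeps the distance bound \<open>1 / 4\<close>.\<close>
      define x where "x = csqrt z"
      have xx: "x * x = z" by (simp add: x_def flip: power2_eq_square)
      have x1: "cmod x = 1" "cmod (- x) = 1"
        using z xx norm_mult[of x x] by (auto simp: abs_square_eq_1 simp flip: power2_eq_square)
      from qi[OF x1(1)] obtain a b where a: "a = csc x k + csc x (k * a)"
        and b: "b = csc (t * x) k + csc (t * x) (k * b)" and ab: "norm (a - b) \<le> 1 / 4" by blast
      from qi[OF x1(2)] obtain a' b' where a': "a' = csc (- x) k + csc (- x) (k * a')"
        and b': "b' = csc (t * - x) k + csc (t * - x) (k * b')" and ab': "norm (a' - b') \<le> 1 / 4" by blast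
      have b'': "b' = csc (- (t * x)) k + csc (- (t * x)) (k * b')" using b' by simp
      have "norm ((1 / 2) *\<^sub>R (a + a') - (1 / 2) *\<^sub>R (b + b')) = norm ((1 / 2) *\<^sub>R ((a - b) + (a' - b')))"
        by (simp add: algebra_simps)
      also have "\<dots> \<le> 1 / 4" using ab ab' norm_triangle_ineq[of "a - b" "a' - b'"] by simp
      finally have n: "norm ((1 / 2) *\<^sub>R (a + a') - (1 / 2) *\<^sub>R (b + b')) \<le> 1 / 4" .
      have txx: "t * t * z = (t * x) * (t * x)" by (simp add: xx[symmetric])
      show "\<exists>a b. a = csc z (k * k) + csc z (k * k * a) \<and>
          b = csc (complex_of_real (s ^ (2 ^ Suc m)) * z) (k * k) + csc (complex_of_real (s ^ (2 ^ Suc m)) * z) (k * k * b)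
          \<and> norm (a - b) \<le> 1 / 4"
        unfolding tt txx
        using quasi_inverse_doubling[OF a a'] quasi_inverse_doubling[OF b b''] n
        unfolding xx by blast
    qed
  qed
  have "(\<lambda>m. s ^ m) \<longlonglongrightarrow> 0" using s by (simp add: LIMSEQ_power_zero)
  \<comment> \<open>With inner radius below \<open>1 / 10\<close> the inner quasi-inverse has norm
    at most \<open>1 / 9\<close>, so \<open>norm k \<le> 2 * norm a \<le> 13 / 18\<close>, against
    \<open>norm k = 1\<close>.\<close>
  then obtain N where N: "s ^ N < 1 / 10"
    by (metis (no_types, lifting) LIMSEQ_iff abs_le_self_iff diff_zero dual_order.refl order_le_less_trans real_norm_def zero_less_divide_1_iff zero_less_numeral abs_ge_self)
  have "s ^ (2 ^ N) \<le> s ^ N" using s by (intro power_decreasing) (auto intro: less_imp_le[OF less_exp])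
  with N have sN: "s ^ (2 ^ N) < 1 / 10" by simp
  define t where "t = s ^ (2 ^ N)"
  have t: "0 \<le> t" "t < 1 / 10" using sN s by (simp_all add: t_def)
  from it[of N, folded t_def] obtain k a b where k: "norm k = 1"
    and a: "a = csc 1 k + csc 1 (k * a)"
    and b: "b = csc (complex_of_real t * 1) k + csc (complex_of_real t * 1) (k * b)"
    and ab: "norm (a - b) \<le> 1 / 4" by (metis norm_one)
  have "norm b \<le> t * norm k + t * norm (k * b)"
    by (subst b) (use t in \<open>auto intro!: order_trans[OF norm_triangle_ineq] simp: csc_of_real\<close>)
  also have "\<dots> \<le> t * 1 + t * norm b"
    using t norm_mult_ineq[of k b] k by (intro add_mono mult_left_mono) auto
  also have "\<dots> \<le> 1 / 10 + 1 / 10 * norm b"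
    using t by (intro add_mono mult_right_mono) auto
  finally have "norm b \<le> 1 / 9" by simp
  then have an: "norm a \<le> 1 / 9 + 1 / 4" using ab norm_triangle_sub[of a b] by simp
  have "k = a - k * a" using a by (simp add: csc_one algebra_simps)
  then have "norm k \<le> norm a + norm (k * a)" by (metis norm_triangle_ineq4)
  also have "norm (k * a) \<le> norm a" using norm_mult_ineq[of k a] k by simp
  finally show False using an k by simp
qed

text \<open>The inverse of \<open>1 - z k\<close> is written as \<open>1 + w\<close>: its scalar
  part must be 1, and the two one-sided identities become the two equations for the quasi-inverse
  \<open>w\<close>.\<close>

lemma uinvertibleD:
  assumes "uinvertible csc (csc (- z) k, 1)"
  shows "\<exists>w. w = csc z k + csc z (k * w) \<and> w = csc z k + csc z (w * k)"
proof -
  obtain w d where w: "umult csc (csc (- z) k, 1) (w, d) = (0, 1)" "umult csc (w, d) (csc (- z) k, 1) = (0, 1)"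
    using assms unfolding uinvertible_def by auto
  have "d = 1" using w by (simp add: umult_def)
  then have "csc (- z) k * w + w + csc (- z) k = 0" "w * csc (- z) k + csc (- z) k + w = 0"
    using w by (simp_all add: umult_def csc_one)
  then have "- csc z (k * w) + w - csc z k = 0" "- csc z (w * k) - csc z k + w = 0"
    by (simp_all add: csc_minus_left csc_mult_left csc_mult_right)
  then have "w = csc z k + csc z (k * w)" "w = csc z k + csc z (w * k)"
    by (metis add.commute add_diff_cancel_left' diff_add_cancel diff_conv_add_uminus eq_iff_diff_eq_0
        minus_add_cancel)+
  then show ?thesis by blast
qed

text \<open>A self-adjoint element of norm 1 has a nonzero spectral value, shown without complex
  analysis. Otherwise quasi-inverses exist at every \<open>z\<close> and depend continuously on
  \<open>z\<close>, hence uniformly so on the closed disc; comparing radius 1 with a radius close to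
  1 contradicts the squaring argument above.\<close>

lemma selfadjoint_unit_not_quasinilpotent:
  assumes k: "star k = k" "norm k = 1"
    and inv: "\<And>z. \<exists>w. w = csc z k + csc z (k * w) \<and> w = csc z k + csc z (w * k)"
  shows False
proof -
  define w where "w z = (SOME w. w = csc z k + csc z (k * w) \<and> w = csc z k + csc z (w * k))" for z
  have w: "w z = csc z k + csc z (k * w z)" "w z = csc z k + csc z (w z * k)" for z
    using someI_ex[OF inv[of z]] unfolding w_def by auto
  \<comment> \<open>Resolvent identity: expand \<open>w z\<close> by its second equation and
    \<open>w y\<close> by its first, so that corresponding terms differ only in the scalars
    \<open>z\<close> and \<open>y\<close>.\<close>
  have resolvent: "w y - w z = csc (y - z) (k + k * w y + w z * k + w z * (k * w y))" for y z
  proof -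
    have "w z + w z * w y = csc z k + csc z (w z * k) + csc z (k * w y) + csc z (w z * (k * w y))"
      by (subst w(2), subst (2) w(2)) (simp add: distrib_right csc_mult_left add.assoc mult.assoc)
    moreover have "w y + w z * w y = csc y k + csc y (k * w y) + csc y (w z * k) + csc y (w z * (k * w y))"
      by (subst (3) w(1), subst (1) w(1)) (simp add: distrib_left csc_mult_right add.assoc)
    moreover have "w y - w z = (w y + w z * w y) - (w z + w z * w y)" by simp
    ultimately have "w y - w z = (csc y k + csc y (k * w y) + csc y (w z * k) + csc y (w z * (k * w y)))
        - (csc z k + csc z (w z * k) + csc z (k * w y) + csc z (w z * (k * w y)))"
      by (simp only:)
    then show ?thesis
      by (simp add: csc_diff_left csc_add_right algebra_simps)
  qed
  have bound: "norm (w y - w z) \<le> cmod (y - z) * ((1 + norm (w z)) * (1 + norm (w y)))" for y z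
  proof -
    have 1: "norm (k * w y) \<le> norm (w y)" "norm (w z * k) \<le> norm (w z)"
      using norm_mult_ineq[of k "w y"] norm_mult_ineq[of "w z" k] k by auto
    then have 2: "norm (w z * (k * w y)) \<le> norm (w z) * norm (w y)"
      by (meson norm_mult_ineq mult_left_mono norm_ge_zero order_trans)
    have "norm (k + k * w y + w z * k + w z * (k * w y)) \<le> 1 + norm (w y) + norm (w z) + norm (w z) * norm (w y)"
      using 1 2 k(2) by (intro order_trans[OF norm_triangle_ineq] add_mono) auto
    also have "\<dots> = (1 + norm (w z)) * (1 + norm (w y))" by (simp add: algebra_simps)
    finally show ?thesis unfolding resolvent norm_csc by (intro mult_left_mono) auto
  qed
  have "continuous_on (cball 0 1) w"
    unfolding continuous_on_iff
  proof (intro ballI allI impI)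
    fix z :: complex and \<epsilon> :: real assume \<epsilon>: "0 < \<epsilon>"
    define M where "M = 1 + norm (w z)"
    have M: "M \<ge> 1" by (simp add: M_def)
    \<comment> \<open>With this radius \<open>cmod (y - z) * M\<^sup>2\<close> stays below
      \<open>1 / 2\<close> and \<open>\<epsilon> / 2\<close>: the first bound absorbs the term in
      \<open>n\<close> into the left side, the second gives the final estimate.\<close>
    define d where "d = min 1 \<epsilon> / (2 * M\<^sup>2)"
    have d: "d > 0" using \<epsilon> M by (simp add: d_def)
    show "\<exists>d>0. \<forall>y\<in>cball 0 1. dist y z < d \<longrightarrow> dist (w y) (w z) < \<epsilon>"
    proof (intro exI[of _ d] conjI ballI impI d)
      fix y assume "dist y z < d"
      then have yz: "cmod (y - z) < min 1 \<epsilon> / (2 * M\<^sup>2)" by (simp add: dist_norm d_def)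
      define D where "D = cmod (y - z) * M\<^sup>2"
      have D: "D < min 1 \<epsilon> / 2" "0 \<le> D"
        using yz M by (simp_all add: D_def field_simps)
      define n where "n = norm (w y - w z)"
      have "n \<le> cmod (y - z) * (M * (M + n))"
      proof -
        have "1 + norm (w y) \<le> M + n"
          using norm_triangle_sub[of "w y" "w z"] by (simp add: M_def n_def)
        then have "cmod (y - z) * (M * (1 + norm (w y))) \<le> cmod (y - z) * (M * (M + n))"
          using M by (intro mult_left_mono) auto
        then show ?thesis using bound[of y z] by (simp add: n_def M_def)
      qed
      also have "\<dots> \<le> cmod (y - z) * (M\<^sup>2 * (1 + n))"
      proof -
        have "M * n \<le> M\<^sup>2 * n" using M by (intro mult_right_mono) (auto simp: n_def power2_eq_square)
        then have "M * (M + n) \<le> M\<^sup>2 * (1 + n)" by (simp add: algebra_simps power2_eq_square)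
        then show ?thesis by (rule mult_left_mono) simp
      qed
      also have "\<dots> = D + D * n" by (simp add: D_def algebra_simps)
      also have "\<dots> \<le> D + 1 / 2 * n" using D by (intro add_mono mult_right_mono) (auto simp: n_def)
      finally have "n \<le> 2 * D" by simp
      then show "dist (w y) (w z) < \<epsilon>" using D by (simp add: dist_norm n_def)
    qed
  qed
  then have "uniformly_continuous_on (cball 0 1) w"
    by (rule compact_uniformly_continuous) simp
  then obtain d where d: "d > 0" and uc: "\<And>y z. y \<in> cball 0 1 \<Longrightarrow> z \<in> cball 0 1 \<Longrightarrow> dist y z < d \<Longrightarrow> dist (w y) (w z) < 1 / 4"
    unfolding uniformly_continuous_on_def by (metis zero_less_divide_1_iff zero_less_numeral)
  define s where "s = 1 - min 1 d / 2"
  have s: "0 \<le> s" "s < 1" "1 - s < d" using d by (auto simp: s_def)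
  show False
  proof (rule no_uniform_quasi_inverse[OF k s(1,2)])
    fix z :: complex assume z: "cmod z = 1"
    have "z - s * z = complex_of_real (1 - s) * z" by (simp add: algebra_simps)
    then have "dist z (s * z) < d" using s z by (simp add: dist_norm norm_mult del: of_real_diff)
    then have "norm (w z - w (s * z)) \<le> 1 / 4"
      using uc[of z "s * z"] z s by (simp add: dist_norm norm_mult less_imp_le)
    then show "\<exists>a b. a = csc z k + csc z (k * a) \<and>
      b = csc (s * z) k + csc (s * z) (k * b) \<and> norm (a - b) \<le> 1 / 4"
      using w(1) by blast
  qed
qed

lemma selfadjoint_quasinilpotent_eq_0:
  assumes k: "star k = k" and inv: "\<And>z. uinvertible csc (csc (- z) k, 1)"
  shows "k = 0"
proof (rule ccontr)
  assume "k \<noteq> 0"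
  define h where "h = (1 / norm k) *\<^sub>R k"
  have csc_h: "csc z h = csc (z / norm k) k" for z
    by (simp add: h_def flip: csc_of_real csc_mult)
  have h: "star h = h" "norm h = 1" using k \<open>k \<noteq> 0\<close> by (simp_all add: h_def star_scaleR)
  have "uinvertible csc (csc (- z) h, 1)" for z
    using inv[of "z / norm k"] by (simp add: csc_h)
  then show False using selfadjoint_unit_not_quasinilpotent[OF h] uinvertibleD by blast
qed

end

section \<open>Elements with finite spectrum\<close>

text \<open>Lagrange interpolation. The point \<open>\<nu>\<close> may lie outside \<open>S\<close>,
  and then the polynomial vanishes on all of \<open>S\<close>.\<close>

lemma ex_lagrange_poly:
  fixes S :: "'b::field set"
  assumes "finite S"
  shows "\<exists>Q. \<forall>\<mu>\<in>S. poly Q \<mu> = (if \<mu> = \<nu> then 1 else 0)"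
proof
  define Q where "Q = smult (1 / (\<Prod>\<mu>\<in>S - {\<nu>}. \<nu> - \<mu>)) (\<Prod>\<mu>\<in>S - {\<nu>}. [:- \<mu>, 1:])"
  have "poly Q \<nu> = 1"
    using assms by (simp add: Q_def poly_prod)
  moreover have "poly Q \<mu> = 0" if "\<mu> \<in> S" "\<mu> \<noteq> \<nu>" for \<mu>
    using assms that by (auto simp: Q_def poly_prod)
  ultimately show "\<forall>\<mu>\<in>S. poly Q \<mu> = (if \<mu> = \<nu> then 1 else 0)" by simp
qed

context cstar
begin

section \<open>Arithmetic, invertibility and polynomial calculus in the unitization\<close>

lemma umult_pair: "umult csc (a, c) (b, d) = (a * b + csc c b + csc d a, c * d)"
  by (simp add: umult_def)

lemma umult_assoc: "umult csc (umult csc x y) z = umult csc x (umult csc y z)"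
  by (cases x; cases y; cases z)
     (simp add: umult_pair distrib_left distrib_right csc_add_right csc_mult_left csc_mult_right
        csc_mult[symmetric] mult.assoc ac_simps)

lemma umult_add_left: "umult csc (x + y) z = umult csc x z + umult csc y z"
  by (cases x; cases y; cases z)
     (simp add: umult_pair algebra_simps csc_add_right csc_add_left)

lemma umult_add_right: "umult csc x (y + z) = umult csc x y + umult csc x z"
  by (cases x; cases y; cases z)
     (simp add: umult_pair algebra_simps csc_add_right csc_add_left)

lemma umult_zero: "umult csc x (0, 0) = (0, 0)" "umult csc (0, 0) x = (0, 0)"
  by (cases x; simp add: umult_pair csc_zero_left csc_zero_right)+

lemma umult_one: "umult csc x (0, 1) = x" "umult csc (0, 1) x = x"
  by (cases x; simp add: umult_pair csc_one csc_zero_right)+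

lemma ustar_umult: "ustar star (umult csc x y) = umult csc (ustar star y) (ustar star x)"
  by (cases x; cases y) (simp add: umult_pair ustar_def star_add star_mult star_csc)

lemma uinvertible_umult:
  assumes "uinvertible csc x" "uinvertible csc y"
  shows "uinvertible csc (umult csc x y)"
proof -
  obtain v w where v: "umult csc x v = (0, 1)" "umult csc v x = (0, 1)"
    and w: "umult csc y w = (0, 1)" "umult csc w y = (0, 1)"
    using assms unfolding uinvertible_def by blast
  have "umult csc (umult csc x y) (umult csc w v) = umult csc x (umult csc (umult csc y w) v)"
    by (simp only: umult_assoc)
  moreover have "umult csc (umult csc w v) (umult csc x y) = umult csc w (umult csc (umult csc v x) y)"
    by (simp only: umult_assoc)
  ultimately show ?thesis
    unfolding uinvertible_def using v w by (metis umult_one(2))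
qed

lemma uinvertible_ustar:
  assumes "uinvertible csc x"
  shows "uinvertible csc (ustar star x)"
proof -
  obtain w where w: "umult csc x w = (0, 1)" "umult csc w x = (0, 1)"
    using assms unfolding uinvertible_def by blast
  have "ustar star (0, 1) = (0, 1)" by (simp add: ustar_def star_zero)
  then show ?thesis unfolding uinvertible_def using w by (metis ustar_umult)
qed

text \<open>The scalar coordinate is multiplicative and kills \<open>(y, 0)\<close>. A polynomial
  that vanishes on the spectrum therefore has no constant term, which keeps its value at
  \<open>y\<close> inside the algebra.\<close>

lemma zero_in_uspectrum: "0 \<in> uspectrum csc y"
  by (auto simp: uspectrum_def uinvertible_def umult_def)

lemma cnj_in_uspectrum:
  assumes "star y = y" "\<mu> \<in> uspectrum csc y"
  shows "cnj \<mu> \<in> uspectrum csc y"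
proof -
  have "ustar star (y, - cnj \<mu>) = (y, - \<mu>)" by (simp add: ustar_def assms)
  then show ?thesis using assms(2) uinvertible_ustar[of "(y, - cnj \<mu>)"] by (auto simp: uspectrum_def)
qed

text \<open>Horner's scheme for \<open>f(y)\<close>; the values live in the unitization, where
  constant terms make sense.\<close>

definition ev :: "'a \<Rightarrow> complex poly \<Rightarrow> 'a \<times> complex" where
  "ev y f = fold_coeffs (\<lambda>c x. umult csc (y, 0) x + (0, c)) f (0, 0)"

lemma ev_0: "ev y 0 = (0, 0)"
  by (simp add: ev_def)

lemma ev_pCons: "ev y (pCons c f) = umult csc (y, 0) (ev y f) + (0, c)"
  by (cases "c = 0 \<and> f = 0") (auto simp: ev_def umult_zero)

lemma ev_add: "ev y (f + g) = ev y f + ev y g"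
proof (induction f g rule: poly_induct2)
  case (pCons a p b q)
  have "(0::'a, a + b) = (0, a) + (0, b)" by simp
  then show ?case unfolding add_pCons ev_pCons pCons umult_add_right by (simp only: ac_simps)
qed (simp add: ev_0)

lemma ev_smult: "ev y (smult c f) = umult csc (0, c) (ev y f)"
proof (induction f)
  case (pCons a p)
  have "umult csc (y, 0) (umult csc (0, c) x) = umult csc (0, c) (umult csc (y, 0) x)" for x
    by (cases x) (simp add: umult_pair csc_zero_left csc_zero_right csc_mult_right csc_add_right
        mult.commute flip: csc_mult)
  then show ?case
    by (simp add: ev_pCons pCons umult_add_right) (simp add: umult_pair csc_zero_right)
qed (simp add: ev_0 umult_zero)

lemma ev_mult: "ev y (f * g) = umult csc (ev y f) (ev y g)"
proof (induction f)
  case (pCons a p)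
  have "ev y (pCons a p * g) = umult csc (0, a) (ev y g) + (umult csc (y, 0) (ev y (p * g)) + (0, 0))"
    by (simp add: ev_add ev_smult ev_pCons)
  also have "(0::'a, 0::complex) = 0" by (simp add: zero_prod_def)
  finally show ?case
    by (simp add: pCons ev_pCons umult_add_left umult_assoc add.commute)
qed (simp add: ev_0 umult_zero)

lemma ev_linear: "ev y [:c, d:] = (csc d y, c)"
  by (simp add: ev_pCons ev_0 umult_pair csc_zero_left csc_zero_right)

lemma ev_const: "ev y [:c:] = (0, c)"
  by (simp add: ev_pCons ev_0 umult_zero)

lemma snd_ev: "snd (ev y f) = poly f 0"
  by (cases f) (simp add: ev_pCons umult_def)

lemma ev_sum: "ev y (sum f F) = (\<Sum>i\<in>F. ev y (f i))"
  by (induction F rule: infinite_finite_induct) (simp_all add: ev_add ev_0 zero_prod_def)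

lemma ev_map_cnj:
  assumes "star y = y"
  shows "ev y (map_poly cnj f) = ustar star (ev y f)"
proof (induction f)
  case (pCons a p)
  define g where "g = map_poly cnj p"
  have add: "ustar star (u + v) = ustar star u + ustar star v" for u v
    by (simp add: ustar_def star_add)
  have y: "(y, 0) = ev y [:0, 1:]" by (simp add: ev_linear csc_one)
  have "umult csc (y, 0) (ev y g) = umult csc (ev y g) (y, 0)"
    unfolding y ev_mult[symmetric] by (simp only: mult.commute)
  moreover have "ustar star (y, 0) = (y, 0)" "ustar star (0, a) = (0, cnj a)"
    by (simp_all add: ustar_def assms star_zero)
  ultimately show ?case
    using pCons by (simp add: map_poly_pCons ev_pCons ustar_umult add g_def)
qed (simp add: ev_0 ustar_def star_zero)

text \<open>One half of the spectral mapping theorem, by splitting off linear factors over the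
  complex numbers. No root of \<open>f\<close> is in the spectrum, so each factor is invertible; the
  remaining constant is nonzero because the spectrum contains 0.\<close>

lemma uinvertible_ev:
  assumes "\<And>\<mu>. \<mu> \<in> uspectrum csc y \<Longrightarrow> poly f \<mu> \<noteq> 0"
  shows "uinvertible csc (ev y f)"
  using assms
proof (induction "degree f" arbitrary: f rule: less_induct)
  case less
  show ?case
  proof (cases "degree f = 0")
    case True
    then obtain c where f: "f = [:c:]" by (auto elim: degree_eq_zeroE)
    have "c \<noteq> 0" using less.prems[OF zero_in_uspectrum] by (simp add: f)
    then show ?thesis
      unfolding f ev_const uinvertible_def
      by (intro exI[of _ "(0, 1 / c)"]) (simp add: umult_pair csc_zero_right)
  next
    case False
    then obtain \<mu> where \<mu>: "poly f \<mu> = 0"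
      using alg_closed_imp_poly_has_root[of f] by auto
    then obtain g where g: "f = [:- \<mu>, 1:] * g" by (auto simp: poly_eq_0_iff_dvd elim: dvdE)
    have "g \<noteq> 0" using False g by auto
    then have "degree f = 1 + degree g" unfolding g by (subst degree_mult_eq) auto
    then have "uinvertible csc (ev y g)"
      using less.prems by (intro less.hyps) (auto simp: g)
    moreover have "uinvertible csc (ev y [:- \<mu>, 1:])"
      using less.prems[of \<mu>] \<mu> by (auto simp: uspectrum_def ev_linear csc_one)
    ultimately show ?thesis unfolding g ev_mult by (rule uinvertible_umult[rotated])
  qed
qed

text \<open>Write \<open>ev y f = (P, 0)\<close> and \<open>k = star P * P\<close>. For every
  \<open>z\<close> the polynomial behind \<open>1 - z k\<close> is 1 on the spectrum, so
  \<open>1 - z k\<close> is invertible; hence \<open>k = 0\<close>, and \<open>P = 0\<close> by the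
  C*-identity.\<close>

lemma ev_eq_0:
  assumes y: "star y = y" and f: "\<And>\<mu>. \<mu> \<in> uspectrum csc y \<Longrightarrow> poly f \<mu> = 0"
  shows "ev y f = (0, 0)"
proof -
  have "snd (ev y f) = 0" using f[OF zero_in_uspectrum] by (simp add: snd_ev)
  then obtain P where P: "ev y f = (P, 0)" by (metis prod.collapse)
  define k where "k = star P * P"
  have k: "ev y (map_poly cnj f * f) = (k, 0)"
    by (simp add: ev_mult ev_map_cnj[OF y] P ustar_def umult_pair k_def csc_zero_left)
  have "k = 0"
  proof (rule selfadjoint_quasinilpotent_eq_0)
    show "star k = k" by (simp add: k_def star_mult star_star)
    fix z
    have "uinvertible csc (ev y ([:1:] + smult (- z) (map_poly cnj f * f)))"
      by (rule uinvertible_ev) (simp add: f)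
    then show "uinvertible csc (csc (- z) k, 1)"
      by (simp add: ev_add ev_const ev_smult k umult_pair csc_zero_left csc_zero_right
          del: mult_pCons_left smult_minus_left)
  qed
  then show ?thesis by (simp add: P k_def star_mult_self_eq_0)
qed

lemma ev_cong:
  assumes "star y = y" and "\<And>\<mu>. \<mu> \<in> uspectrum csc y \<Longrightarrow> poly f \<mu> = poly g \<mu>"
  shows "ev y f = ev y g"
proof -
  have "ev y (f - g) = (0, 0)" by (rule ev_eq_0) (simp_all add: assms)
  then show ?thesis using ev_add[of y "f - g" g] by (simp flip: zero_prod_def)
qed

text \<open>Polynomials that agree on the spectrum agree at \<open>y\<close>. So the Lagrange
  polynomials evaluate to orthogonal idempotents \<open>E \<nu>\<close>, and interpolating the
  identity polynomial expresses \<open>y\<close> through them.\<close>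

lemma finite_spectrum_decomposition:
  assumes y: "star y = y" and fin: "finite (uspectrum csc y)"
  shows "\<exists>F e. orth_proj_family F e \<and> y = (\<Sum>l\<in>F. l *\<^sub>R e l)"
proof -
  define S where "S = uspectrum csc y"
  have "\<forall>\<nu>. \<exists>Q. \<forall>\<mu>\<in>S. poly Q \<mu> = (if \<mu> = \<nu> then 1 else 0)"
    using ex_lagrange_poly fin unfolding S_def by blast
  then obtain Q where Q: "\<And>\<nu> \<mu>. \<mu> \<in> S \<Longrightarrow> poly (Q \<nu>) \<mu> = (if \<mu> = \<nu> then 1 else 0)"
    by metis
  have cnjS: "cnj \<mu> \<in> S" if "\<mu> \<in> S" for \<mu>
    using cnj_in_uspectrum[OF y] that unfolding S_def by blast
  define E where "E \<nu> = fst (ev y (Q \<nu>))" for \<nu>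
  \<comment> \<open>The point 0 is left out: \<open>Q 0\<close> takes the value 1 at 0, so it does
    not evaluate into the algebra, and its term in the sum has coefficient 0.\<close>
  have evQ: "ev y (Q \<nu>) = (E \<nu>, 0)" if "\<nu> \<noteq> 0" for \<nu>
    using that Q[of 0 \<nu>] zero_in_uspectrum snd_ev[of y "Q \<nu>"]
    by (simp add: E_def S_def prod_eq_iff)
  have cong: "ev y f = ev y g" if "\<And>\<mu>. \<mu> \<in> S \<Longrightarrow> poly f \<mu> = poly g \<mu>" for f g
    by (rule ev_cong[OF y]) (use that S_def in auto)
  have mult: "E \<nu> * E \<mu> = (if \<nu> = \<mu> then E \<nu> else 0)" if "\<nu> \<noteq> 0" "\<mu> \<noteq> 0" for \<nu> \<mu>
  proof -
    have "ev y (Q \<nu> * Q \<mu>) = ev y (if \<nu> = \<mu> then Q \<nu> else 0)"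
      by (rule cong) (auto simp: Q)
    then show ?thesis
      using that by (auto simp: ev_mult evQ umult_pair csc_zero_left ev_0 split: if_splits)
  qed
  have selfadj: "star (E \<nu>) = E \<nu>" if "\<nu> \<noteq> 0" "cnj \<nu> = \<nu>" for \<nu>
  proof -
    have "cnj \<mu> = \<nu> \<longleftrightarrow> \<mu> = \<nu>" for \<mu>
      using that(2) by (metis complex_cnj_cnj)
    then have "ev y (map_poly cnj (Q \<nu>)) = ev y (Q \<nu>)"
      by (intro cong) (simp add: Q cnjS)
    then show ?thesis using that by (simp add: ev_map_cnj[OF y] evQ ustar_def)
  qed
  \<comment> \<open>Nonreal spectral points contribute nothing: on the spectrum
    \<open>Q \<nu>\<close> lives at \<open>\<nu>\<close> and its conjugate polynomial at
    \<open>cnj \<nu>\<close>, so their product vanishes there.\<close>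
  have nonreal: "E \<nu> = 0" if "cnj \<nu> \<noteq> \<nu>" for \<nu>
  proof -
    have l0: "\<nu> \<noteq> 0" using that by auto
    have "ev y (map_poly cnj (Q \<nu>) * Q \<nu>) = ev y 0"
      by (rule cong) (use that in \<open>auto simp: Q cnjS\<close>)
    then have "star (E \<nu>) * E \<nu> = 0"
      by (simp add: ev_mult ev_map_cnj[OF y] evQ[OF l0] ustar_def umult_pair csc_zero_left ev_0)
    then show ?thesis by (simp add: star_mult_self_eq_0)
  qed
  define F where "F = {l::real. l \<noteq> 0 \<and> complex_of_real l \<in> S}"
  define e where "e l = E (complex_of_real l)" for l
  have "complex_of_real ` F \<subseteq> S" by (auto simp: F_def)
  then have "finite F" using fin unfolding S_def by (metis finite_imageD finite_subset inj_of_real inj_on_subset subset_UNIV)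
  then have fam: "orth_proj_family F e"
    unfolding orth_proj_family_def proj_def e_def F_def by (auto simp: mult selfadj)
  have real_in_F: "\<nu> \<in> complex_of_real ` F" if "\<nu> \<in> S" "\<nu> \<noteq> 0" "cnj \<nu> = \<nu>" for \<nu>
  proof -
    have "\<nu> = complex_of_real (Re \<nu>)" using that(3) by (simp add: complex_eq_iff)
    then show ?thesis
      using that(1,2) unfolding F_def by (metis (mono_tags, lifting) image_eqI mem_Collect_eq of_real_0)
  qed
  have finS: "finite S" using fin by (simp add: S_def)
  have "ev y [:0, 1:] = ev y (\<Sum>\<nu>\<in>S - {0}. smult \<nu> (Q \<nu>))"
  proof (rule cong)
    fix \<mu> assume \<mu>: "\<mu> \<in> S"
    have "(\<Sum>\<nu>\<in>S - {0}. \<nu> * poly (Q \<nu>) \<mu>) = (\<Sum>\<nu>\<in>S - {0}. if \<nu> = \<mu> then \<mu> else 0)"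
      using \<mu> by (intro sum.cong) (auto simp: Q)
    also have "\<dots> = \<mu>" using finS \<mu> by simp
    finally show "poly [:0, 1:] \<mu> = poly (\<Sum>\<nu>\<in>S - {0}. smult \<nu> (Q \<nu>)) \<mu>"
      by (simp add: poly_sum)
  qed
  also have "\<dots> = (\<Sum>\<nu>\<in>S - {0}. (csc \<nu> (E \<nu>), 0))"
    unfolding ev_sum by (intro sum.cong refl) (auto simp: ev_smult evQ umult_pair csc_zero_left csc_zero_right)
  finally have "y = fst (\<Sum>\<nu>\<in>S - {0}. (csc \<nu> (E \<nu>), 0::complex))"
    by (simp add: ev_linear csc_one prod_eq_iff)
  also have "\<dots> = (\<Sum>\<nu>\<in>S - {0}. csc \<nu> (E \<nu>))" by (simp add: fst_sum)
  also have "\<dots> = (\<Sum>\<nu>\<in>complex_of_real ` F. csc \<nu> (E \<nu>))"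
  proof (rule sum.mono_neutral_right)
    show "finite (S - {0})" using finS by simp
    show "complex_of_real ` F \<subseteq> S - {0}" by (auto simp: F_def)
    have "cnj \<nu> \<noteq> \<nu>" if "\<nu> \<in> S - {0} - complex_of_real ` F" for \<nu>
      using real_in_F that by blast
    then show "\<forall>\<nu>\<in>S - {0} - complex_of_real ` F. csc \<nu> (E \<nu>) = 0"
      using nonreal csc_zero_right by metis
  qed
  also have "\<dots> = (\<Sum>l\<in>F. l *\<^sub>R e l)"
    by (subst sum.reindex) (auto simp: inj_on_def csc_of_real e_def)
  finally show ?thesis using fam by blast
qed

section \<open>Approximate supports\<close>

text \<open>Dropping the vanishing \<open>e l\<close> makes every remaining \<open>l\<close> a
  genuine eigenvalue, so that norm bounds for the sum carry over to each \<open>l\<close>.\<close>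

lemma ex_finite_spectrum_approx:
  assumes "real_rank_zero csc star" "star x = x" "\<epsilon> > 0"
  shows "\<exists>F e. orth_proj_family F e \<and> (\<forall>l\<in>F. e l \<noteq> 0) \<and> norm (x - (\<Sum>l\<in>F. l *\<^sub>R e l)) < \<epsilon>"
proof -
  obtain y where y: "star y = y" "finite (uspectrum csc y)" "norm (x - y) < \<epsilon>"
    using assms unfolding real_rank_zero_def by blast
  obtain F e where fam: "orth_proj_family F e" and sum: "y = (\<Sum>l\<in>F. l *\<^sub>R e l)"
    using finite_spectrum_decomposition[OF y(1,2)] by blast
  define G where "G = {l\<in>F. e l \<noteq> 0}"
  have fin: "finite F" using fam by (simp add: orth_proj_family_def)
  have "(\<Sum>l\<in>F. l *\<^sub>R e l) = (\<Sum>l\<in>G. l *\<^sub>R e l)"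
    by (rule sum.mono_neutral_right[OF fin]) (auto simp: G_def)
  moreover have "orth_proj_family G e"
    using fam by (rule orth_proj_family_subset) (simp add: G_def)
  ultimately show ?thesis
    using y(3) sum by (intro exI[of _ G] exI[of _ e]) (auto simp: G_def)
qed

text \<open>A quantitative form of the positivity of \<open>h * h\<close>: for large
  \<open>t\<close>, multiplication by \<open>t - h * h\<close> should have norm at most
  \<open>t\<close>. The argument runs on a finite-spectrum approximation, which costs the slack
  \<open>1 / 2\<close>.\<close>

lemma norm_diff_square_le:
  assumes rr: "real_rank_zero csc star" and h: "star h = h"
    and t: "t \<ge> (norm h + 1)\<^sup>2"
  shows "norm (t *\<^sub>R y - h * h * y) \<le> (t + 1 / 2) * norm y"
proof -
  \<comment> \<open>Chosen so that the error of replacing \<open>h * h\<close> by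
    \<open>g * g\<close> is at most \<open>1 / 2\<close>.\<close>
  define \<epsilon> where "\<epsilon> = 1 / (4 * norm h + 4)"
  have \<epsilon>: "\<epsilon> > 0" "\<epsilon> \<le> 1" "norm h * \<epsilon> + \<epsilon> * (norm h + 1) \<le> 1 / 2"
    using norm_ge_zero[of h] by (simp_all add: \<epsilon>_def divide_simps add_pos_nonneg add_nonneg_pos del: norm_ge_zero)
  obtain F e where fam: "orth_proj_family F e" and nz: "\<forall>l\<in>F. e l \<noteq> 0"
    and d: "norm (h - (\<Sum>l\<in>F. l *\<^sub>R e l)) < \<epsilon>"
    using ex_finite_spectrum_approx[OF rr h \<epsilon>(1)] by blast
  define g where "g = (\<Sum>l\<in>F. l *\<^sub>R e l)"
  have hg: "norm (h - g) < \<epsilon>" using d by (simp add: g_def)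
  have gn: "norm g \<le> norm h + 1"
    using hg \<epsilon> norm_triangle_sub[of g h] by (simp add: norm_minus_commute)
  have "norm (g * g - h * h) = norm (h * (h - g) + (h - g) * g)"
    by (subst norm_minus_commute) (simp add: algebra_simps)
  also have "\<dots> \<le> norm h * norm (h - g) + norm (h - g) * norm g"
    by (intro order_trans[OF norm_triangle_ineq] add_mono norm_mult_ineq)
  also have "\<dots> \<le> norm h * \<epsilon> + \<epsilon> * (norm h + 1)"
    using hg gn \<epsilon> by (intro add_mono mult_mono) auto
  also have "\<dots> \<le> 1 / 2" by (rule \<epsilon>(3))
  finally have sq: "norm (g * g - h * h) \<le> 1 / 2" .
  have "(1::real) \<le> (norm h + 1)\<^sup>2" using norm_ge_zero[of h] by (simp add: power2_eq_square algebra_simps)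
  then have t0: "t > 0" using t by linarith
  have "\<bar>t - l * l\<bar> \<le> t" if "l \<in> F" for l
  proof -
    have "\<bar>l\<bar> \<le> norm g"
      unfolding g_def using norm_orth_sum_ge[OF fam that, of "\<lambda>l. l"] nz that by simp
    then have "\<bar>l\<bar> \<le> norm h + 1" using gn by simp
    then have "l\<^sup>2 \<le> (norm h + 1)\<^sup>2" by (simp add: abs_le_square_iff[symmetric])
    then show ?thesis using t t0 by (simp add: power2_eq_square abs_le_iff)
  qed
  then have "norm (t *\<^sub>R y - (\<Sum>l\<in>F. (t - (t - l * l)) *\<^sub>R (e l * y))) \<le> t * norm y"
    by (intro norm_orth_combination[OF fam t0])
  also have "(\<Sum>l\<in>F. (t - (t - l * l)) *\<^sub>R (e l * y)) = g * g * y"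
    unfolding g_def orth_mult[OF fam] by (simp add: sum_distrib_right)
  finally have gg: "norm (t *\<^sub>R y - g * g * y) \<le> t * norm y" .
  have "norm ((g * g - h * h) * y) \<le> 1 / 2 * norm y"
    by (rule order_trans[OF norm_mult_ineq mult_right_mono[OF sq]]) simp
  moreover have "norm (t *\<^sub>R y - h * h * y) = norm ((t *\<^sub>R y - g * g * y) + (g * g - h * h) * y)"
    by (simp add: algebra_simps)
  moreover have "(t + 1 / 2) * norm y = t * norm y + 1 / 2 * norm y" by (rule distrib_right)
  ultimately show ?thesis
    using gg norm_triangle_ineq[of "t *\<^sub>R y - g * g * y" "(g * g - h * h) * y"]
    by linarith
qed

text \<open>Kaplansky's argument: \<open>f = - u u\<^sup>*\<close> would be a projection, and writing \<open>u\<close> through its real and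
  imaginary parts \<open>h\<close>, \<open>k\<close> exhibits \<open>- 2 (e + f) = h\<^sup>2 + k\<^sup>2\<close>.\<close>

lemma star_mult_self_neq_minus_proj:
  assumes rr: "real_rank_zero csc star" and e: "proj star e" "e \<noteq> 0"
    and u: "star u * u = - e" "u * e = u"
  shows False
proof -
  define f where "f = - (u * star u)"
  have "f * f = u * (star u * u) * star u" by (simp add: f_def mult.assoc)
  also have "\<dots> = - (u * e * star u)" by (simp add: u(1) mult.assoc)
  finally have f: "proj star f"
    by (simp add: u(2) proj_def f_def star_minus star_mult star_star)
  define h where "h = u + star u"
  define k where "k = csc \<i> (u - star u)"
  have h: "star h = h" by (simp add: h_def star_add star_star add.commute)
  have k: "star k = k"
    by (simp add: k_def star_csc star_diff star_star csc_minus_left csc_diff_right)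
  have "k * k = - ((u - star u) * (u - star u))"
    by (simp add: k_def csc_mult_left csc_mult_right csc_minus_left csc_one flip: csc_mult)
  then have hk: "h * h + k * k = - 2 *\<^sub>R e - 2 *\<^sub>R f"
    by (simp add: h_def algebra_simps f_def u(1) scaleR_2)
  define t where "t = max ((norm h + 1)\<^sup>2) ((norm k + 1)\<^sup>2)"
  have ne: "norm e = 1" using e by (rule norm_proj)
  have "norm (t *\<^sub>R e - h * h * e) \<le> t + 1 / 2"
    using norm_diff_square_le[OF rr h, of t e] by (simp add: t_def ne)
  moreover have "norm (t *\<^sub>R e - k * k * e) \<le> t + 1 / 2"
    using norm_diff_square_le[OF rr k, of t e] by (simp add: t_def ne)
  ultimately have "norm ((t *\<^sub>R e - h * h * e) + (t *\<^sub>R e - k * k * e)) \<le> 2 * t + 1"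
    using norm_triangle_ineq[of "t *\<^sub>R e - h * h * e" "t *\<^sub>R e - k * k * e"] by linarith
  also have "(t *\<^sub>R e - h * h * e) + (t *\<^sub>R e - k * k * e) = (2 * t) *\<^sub>R e - (h * h + k * k) * e"
    using scaleR_add_left[of t t e] by (simp add: distrib_right)
  \<comment> \<open>Since \<open>1 - 2 f\<close> is isometric, splitting off
    \<open>e - 2 f e\<close> gives the lower bound \<open>(2 t + 3) - 1\<close>, which exceeds the
    upper bound \<open>2 t + 1\<close>.\<close>
  also have "\<dots> = (2 * t + 3) *\<^sub>R e - (e - 2 *\<^sub>R (f * e))"
  proof -
    have "(2 * t + 3) *\<^sub>R e = (2 * t) *\<^sub>R e + 2 *\<^sub>R e + e"
      using scaleR_add_left[of "2 * t + 2" 1 e] scaleR_add_left[of "2 * t" 2 e] by (simp add: add.commute)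
    then show ?thesis unfolding hk by (simp add: algebra_simps projD(2)[OF e(1)])
  qed
  finally have "norm ((2 * t + 3) *\<^sub>R e - (e - 2 *\<^sub>R (f * e))) \<le> 2 * t + 1" .
  moreover have "norm (e - 2 *\<^sub>R (f * e)) = 1" using norm_symmetry_mult[OF f, of e] ne by simp
  moreover have "t \<ge> 0" by (simp add: t_def le_max_iff_disj)
  then have "norm ((2 * t + 3) *\<^sub>R e) = 2 * t + 3" by (simp add: ne)
  ultimately show False
    using norm_triangle_ineq2[of "(2 * t + 3) *\<^sub>R e" "e - 2 *\<^sub>R (f * e)"] by linarith
qed

text \<open>Positivity of \<open>star c * c + q\<close> in approximate form. A very negative
  \<open>l\<close> makes \<open>q e\<close> small because \<open>q z = q\<close>, so
  \<open>e * (star c * c) * e\<close> is \<open>l\<close> times a small perturbation of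
  \<open>e\<close>. Normalising by an inverse square root in the corner of \<open>e\<close> gives
  \<open>star u * u = - e\<close>, which was excluded.\<close>

lemma approx_eigenvalue_lower_bound:
  assumes rr: "real_rank_zero csc star" and q: "proj star q" and cq: "c * q = 0"
    and e: "proj star e" "e \<noteq> 0" and ye: "y * e = l *\<^sub>R e"
    and near: "norm (star c * c + q - y) \<le> \<epsilon>" and \<epsilon>: "\<epsilon> > 0"
  shows "- 4 * \<epsilon> < l"
proof (rule ccontr)
  assume "\<not> - 4 * \<epsilon> < l"
  then have l: "l \<le> - 4 * \<epsilon>" by simp
  then have l0: "l < 0" using \<epsilon> by linarith
  define z where "z = star c * c + q"
  have ne: "norm e = 1" using e by (rule norm_proj)
  have qc: "q * star c = 0" using arg_cong[OF cq, of star] by (simp add: star_mult projD[OF q] star_zero)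
  have qz: "q * z = q" by (simp add: z_def distrib_left projD[OF q] qc flip: mult.assoc)
  have zye: "norm ((z - y) * e) \<le> \<epsilon>"
    using norm_mult_ineq[of "z - y" e] near by (simp add: z_def ne)
  have "q * ((z - y) * e) = q * z * e - q * (y * e)" by (simp add: algebra_simps)
  then have "(1 - l) *\<^sub>R (q * e) = q * ((z - y) * e)"
    by (simp add: qz ye algebra_simps)
  then have "(1 - l) * norm (q * e) = norm (q * ((z - y) * e))"
    using l0 by (metis abs_of_pos diff_gt_0_iff_gt less_trans norm_scaleR zero_less_one)
  also have "\<dots> \<le> norm q * norm ((z - y) * e)" by (rule norm_mult_ineq)
  also have "\<dots> \<le> 1 * \<epsilon>" using norm_proj_le[OF q] zye \<epsilon> by (intro mult_mono) auto
  finally have "(1 - l) * norm (q * e) \<le> \<epsilon>" by simp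
  moreover have "1 * norm (q * e) \<le> (1 - l) * norm (q * e)"
    using l0 by (intro mult_right_mono) auto
  ultimately have qe: "norm (q * e) \<le> \<epsilon>" by simp
  define D where "D = (z - y) * e - q * e"
  have D: "norm D \<le> 2 * \<epsilon>" using norm_triangle_ineq4[of "(z - y) * e" "q * e"] zye qe by (simp add: D_def)
  have cce: "star c * c * e = l *\<^sub>R e + D" by (simp add: D_def z_def ye algebra_simps)
  \<comment> \<open>The factor 4 in the claim gives
    \<open>norm s \<le> 2 \<epsilon> / \<bar>l\<bar> \<le> 1 / 2\<close>, so \<open>e + s\<close>
    has an inverse square root.\<close>
  define s where "s = (1 / l) *\<^sub>R (e * D)"
  have ecce: "e * (star c * c * e) = l *\<^sub>R (e + s)"
    using l0 by (simp add: cce s_def distrib_left projD[OF e(1)] scaleR_add_right)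
  have es: "e * s = s" by (simp add: s_def proj_mult_cancel[OF e(1)])
  have "star (e * (star c * c * e)) = e * (star c * c * e)"
    by (simp add: star_mult star_star projD[OF e(1)] mult.assoc)
  then have "star s = s"
    unfolding ecce using l0 by (simp add: star_scaleR star_add projD[OF e(1)])
  have "norm (e * D) \<le> 1 * (2 * \<epsilon>)"
    using norm_mult_ineq[of e D] D ne by simp
  then have "norm s \<le> (1 / \<bar>l\<bar>) * (2 * \<epsilon>)"
    unfolding s_def norm_scaleR by (intro mult_mono) auto
  also have "\<dots> < 1" using l l0 \<epsilon> by (simp add: field_simps)
  finally obtain w where w: "star w = w" "w * e = w" "e * w = w" "w * (e + s) * w = e"
    using corner_inverse_sqrt[OF e(1) \<open>star s = s\<close> es] by blast
  define u where "u = (1 / sqrt (- l)) *\<^sub>R (c * e * w)"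
  have sq: "(1 / sqrt (- l)) * (1 / sqrt (- l)) = - (1 / l)"
    using l0 by (simp add: real_sqrt_mult_self)
  have "star u * u = ((1 / sqrt (- l)) * (1 / sqrt (- l))) *\<^sub>R (w * (e * (star c * c * e)) * w)"
    unfolding u_def by (simp add: star_scaleR star_mult w(1) projD[OF e(1)] mult.assoc)
  also have "\<dots> = - (w * (e + s) * w)" unfolding sq ecce using l0 by simp
  finally have "star u * u = - e" by (simp add: w(4))
  moreover have "u * e = u" by (simp add: u_def mult.assoc w(2))
  ultimately show False using star_mult_self_neq_minus_proj[OF rr e] by blast
qed

lemma ex_approximate_support:
  assumes rr: "real_rank_zero csc star" and q: "proj star q" and cq: "c * q = 0" and \<eta>: "\<eta> > 0"
  shows "\<exists>r t. proj star r \<and> norm (c - c * r) \<le> \<eta> \<and> norm (q - q * r) \<le> \<eta> \<and>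
    star t * (star c * c + q) * t = r \<and> t * r = t"
proof -
  \<comment> \<open>The cut at \<open>4 * \<epsilon>\<close> and the approximation error add up to
    \<open>5 * \<epsilon>\<close> for \<open>q\<close>. For \<open>star c * c\<close> the error is
    \<open>10 * \<epsilon>\<close>, compared with \<open>\<eta>\<^sup>2\<close> because the bound
    for \<open>c\<close> comes from a square root.\<close>
  define \<epsilon> where "\<epsilon> = min (\<eta> / 5) (\<eta>\<^sup>2 / 10)"
  have \<epsilon>: "\<epsilon> > 0" "5 * \<epsilon> \<le> \<eta>" "10 * \<epsilon> \<le> \<eta>\<^sup>2" using \<eta> by (simp_all add: \<epsilon>_def min_def)
  define z where "z = star c * c + q"
  have z: "star z = z" by (simp add: z_def star_add star_mult star_star projD[OF q])
  obtain F e where fam: "orth_proj_family F e" and nz: "\<forall>l\<in>F. e l \<noteq> 0"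
    and d: "norm (z - (\<Sum>l\<in>F. l *\<^sub>R e l)) < \<epsilon>"
    using ex_finite_spectrum_approx[OF rr z \<epsilon>(1)] by blast
  define y where "y = (\<Sum>l\<in>F. l *\<^sub>R e l)"
  have zy: "norm (z - y) \<le> \<epsilon>" using d by (simp add: y_def)
  have lower: "- 4 * \<epsilon> < l" if "l \<in> F" for l
  proof (rule approx_eigenvalue_lower_bound[OF rr q cq])
    show "proj star (e l)" "e l \<noteq> 0" using fam nz that by (auto simp: orth_proj_family_def)
    show "y * e l = l *\<^sub>R e l" unfolding y_def by (rule orth_mult_single[OF fam that])
  qed (use zy \<epsilon> in \<open>auto simp: z_def\<close>)
  \<comment> \<open>\<open>r\<close> is the spectral projection of \<open>y\<close> for the values
    from \<open>4 * \<epsilon>\<close> upwards, and \<open>t0\<close> the inverse square root of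
    \<open>y\<close> there. Hence \<open>t0 * y * t0 = r\<close>, while \<open>t0 * z * t0\<close>
    is only within \<open>1 / 4\<close> of \<open>r\<close>, which the corner factor
    \<open>w\<close> corrects.\<close>
  define \<rho> where "\<rho> l = (if l \<ge> 4 * \<epsilon> then 1 else 0 :: real)" for l
  define \<tau> where "\<tau> l = (if l \<ge> 4 * \<epsilon> then 1 / sqrt l else 0 :: real)" for l
  define r where "r = (\<Sum>l\<in>F. \<rho> l *\<^sub>R e l)"
  define t0 where "t0 = (\<Sum>l\<in>F. \<tau> l *\<^sub>R e l)"
  have r: "proj star r"
    unfolding proj_def r_def by (simp add: orth_mult[OF fam] star_orth_sum[OF fam]) (simp add: \<rho>_def if_distrib cong: if_cong)
  have t0: "star t0 = t0" unfolding t0_def by (rule star_orth_sum[OF fam])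
  have t0r: "t0 * r = t0" unfolding t0_def r_def orth_mult[OF fam] by (intro sum.cong) (auto simp: \<tau>_def \<rho>_def)
  have rt0: "r * t0 = t0" unfolding t0_def r_def orth_mult[OF fam] by (intro sum.cong) (auto simp: \<tau>_def \<rho>_def)
  have "\<tau> l * l * \<tau> l = \<rho> l" for l
    using \<epsilon>(1) by (auto simp: \<tau>_def \<rho>_def field_simps)
  then have t0y: "t0 * y * t0 = r" unfolding t0_def y_def r_def orth_mult[OF fam] by simp
  have nt0: "norm t0 \<le> 1 / sqrt (4 * \<epsilon>)"
    unfolding t0_def using \<epsilon>(1) by (intro norm_orth_sum_le[OF fam]) (auto simp: \<tau>_def frac_le)
  define s where "s = t0 * (z - y) * t0"
  have ry: "star y = y" unfolding y_def by (rule star_orth_sum[OF fam])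
  have ss: "star s = s" by (simp add: s_def star_mult star_diff z ry t0 mult.assoc)
  have rs: "r * s = s" by (simp add: s_def rt0 flip: mult.assoc)
  have "norm s \<le> norm t0 * norm (z - y) * norm t0"
    unfolding s_def by (intro order_trans[OF norm_mult_ineq] mult_right_mono norm_mult_ineq) auto
  also have "\<dots> \<le> 1 / sqrt (4 * \<epsilon>) * \<epsilon> * (1 / sqrt (4 * \<epsilon>))"
    using nt0 zy \<epsilon>(1) by (intro mult_mono) auto
  also have "\<dots> < 1" using \<epsilon>(1) by (simp add: field_simps)
  finally obtain w where w: "star w = w" "w * r = w" "w * (r + s) * w = r"
    using corner_inverse_sqrt[OF r ss rs] by blast
  define t where "t = t0 * w"
  have "t0 * z * t0 = r + s" unfolding s_def t0y[symmetric] by (simp add: algebra_simps)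
  then have "w * (t0 * z * t0) * w = r" using w(3) by simp
  then have tz: "star t * z * t = r" by (simp add: t_def star_mult w(1) t0 mult.assoc)
  have tr: "t * r = t" by (simp add: t_def mult.assoc w(2))
  \<comment> \<open>The lower bound for the eigenvalues enters here: a discarded \<open>l\<close>
    lies between \<open>- 4 * \<epsilon>\<close> and \<open>4 * \<epsilon>\<close>.\<close>
  have "norm (\<Sum>l\<in>F. (l - l * \<rho> l) *\<^sub>R e l) \<le> 4 * \<epsilon>"
    using \<epsilon>(1) by (intro norm_orth_sum_le[OF fam]) (auto simp: \<rho>_def abs_le_iff dest!: lower)
  moreover have "y - y * r = (\<Sum>l\<in>F. (l - l * \<rho> l) *\<^sub>R e l)"
    unfolding y_def r_def orth_mult[OF fam] by (simp add: scaleR_diff_left sum_subtractf)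
  ultimately have yr: "norm (y - y * r) \<le> 4 * \<epsilon>" by simp
  have "norm (z - z * r) = norm ((y - y * r) + ((z - y) - (z - y) * r))" by (simp add: algebra_simps)
  then have zr: "norm (z - z * r) \<le> 5 * \<epsilon>"
    using yr norm_diff_proj_right[OF r, of "z - y"] zy norm_triangle_ineq[of "y - y * r" "(z - y) - (z - y) * r"]
    by linarith
  \<comment> \<open>Both summands of \<open>z\<close> inherit the bound: \<open>q\<close> by
    multiplying with \<open>q\<close>, and \<open>star c * c\<close> by subtraction.\<close>
  have qc: "q * star c = 0" using arg_cong[OF cq, of star] by (simp add: star_mult projD[OF q] star_zero)
  have qz: "q * z = q" by (simp add: z_def distrib_left projD[OF q] qc flip: mult.assoc)
  have "q - q * r = q * (z - z * r)" by (simp add: right_diff_distrib qz flip: mult.assoc)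
  also have "norm \<dots> \<le> norm q * norm (z - z * r)" by (rule norm_mult_ineq)
  also have "\<dots> \<le> 1 * (5 * \<epsilon>)" using zr norm_proj_le[OF q] by (intro mult_mono) auto
  finally have qr: "norm (q - q * r) \<le> 5 * \<epsilon>" by simp
  define x where "x = star c * c - star c * c * r"
  have "x = (z - z * r) - (q - q * r)" by (simp add: x_def z_def algebra_simps)
  then have x: "norm x \<le> 10 * \<epsilon>" using zr qr norm_triangle_ineq4[of "z - z * r" "q - q * r"] by simp
  have "star (c - c * r) * (c - c * r) = x - r * x"
    by (simp add: x_def star_diff star_mult projD[OF r] algebra_simps)
  then have "(norm (c - c * r))\<^sup>2 = norm (x - r * x)" by (metis norm_star_mult_self)
  also have "\<dots> \<le> norm x" by (rule norm_diff_proj_left[OF r])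
  also have "\<dots> \<le> \<eta>\<^sup>2" using x \<epsilon>(3) by simp
  finally have "norm (c - c * r) \<le> \<eta>" using \<eta> by (simp add: abs_le_square_iff[symmetric])
  then show ?thesis using r qr \<epsilon>(2) tz tr unfolding z_def by (intro exI[of _ r] exI[of _ t]) auto
qed

end

section \<open>Comparison of projections\<close>

lemma sum_lessThan_add:
  fixes f :: "nat \<Rightarrow> 'b::comm_monoid_add"
  shows "(\<Sum>k<n + m. f k) = (\<Sum>k<n. f k) + (\<Sum>k<m. f (n + k))"
  by (induction m) (simp_all add: add.assoc)

context cstar
begin

section \<open>Matrices with entries in the algebra, and subequivalence of projections\<close>

definition emb :: "(nat \<Rightarrow> nat \<Rightarrow> 'a) \<Rightarrow> nat \<Rightarrow> nat \<Rightarrow> 'a \<times> complex" where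
  "emb X i j = (X i j, 0)"

lemma emb_eq_iff: "emb X = emb Y \<longleftrightarrow> (\<forall>i j. X i j = Y i j)"
  by (auto simp: emb_def fun_eq_iff)

lemma in_A_emb: "in_A (emb X)"
  by (simp add: in_A_def emb_def)

lemma in_A_imp_emb:
  assumes "in_A M"
  obtains X where "M = emb X"
proof
  show "M = emb (\<lambda>i j. fst (M i j))"
    using assms by (simp add: fun_eq_iff emb_def in_A_def prod_eq_iff)
qed

lemma msupp_emb: "msupp n (emb X) \<longleftrightarrow> (\<forall>i j. n \<le> i \<or> n \<le> j \<longrightarrow> X i j = 0)"
  by (auto simp: msupp_def emb_def)

lemma mstar_emb: "mstar star (emb X) = emb (\<lambda>i j. star (X j i))"
  by (simp add: fun_eq_iff mstar_def emb_def ustar_def)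

lemma mmul_emb: "mmul csc n (emb X) (emb Y) = emb (\<lambda>i j. \<Sum>k<n. X i k * Y k j)"
proof -
  have "(\<Sum>k\<in>F. (f k :: 'a, 0 :: complex)) = (sum f F, 0)" for f and F :: "nat set"
    by (induction F rule: infinite_finite_induct) (simp_all add: zero_prod_def)
  then show ?thesis
    by (simp add: fun_eq_iff mmul_def emb_def umult_def csc_zero_left)
qed

lemma is_proj_emb_iff:
  "is_proj csc star n (emb X) \<longleftrightarrow>
     (\<forall>i j. n \<le> i \<or> n \<le> j \<longrightarrow> X i j = 0) \<and> (\<forall>i j. star (X j i) = X i j) \<and>
     (\<forall>i j. (\<Sum>k<n. X i k * X k j) = X i j)"
  by (simp add: is_proj_def is_uproj_def in_A_emb msupp_emb mstar_emb mmul_emb emb_eq_iff)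

lemma is_proj_imp_emb:
  assumes "is_proj csc star n P"
  obtains X where "P = emb X"
  using assms in_A_imp_emb unfolding is_proj_def by blast

lemma mat1_emb: "mat1 p = emb (\<lambda>i j. if i = 0 \<and> j = 0 then p else 0)"
  by (auto simp: fun_eq_iff mat1_def emb_def)

lemma is_proj_mat1: "proj star p \<Longrightarrow> is_proj csc star 1 (mat1 p)"
  by (auto simp: mat1_emb is_proj_emb_iff projD star_zero)

lemma dsum_emb:
  "dsum n (emb X) m (emb Y) = emb (\<lambda>i j. if i < n \<and> j < n then X i j
     else if n \<le> i \<and> n \<le> j then Y (i - n) (j - n) else 0)"
  by (auto simp: fun_eq_iff dsum_def emb_def)

lemma is_proj_dsum:
  assumes "is_proj csc star n P" "is_proj csc star m Q"
  shows "is_proj csc star (n + m) (dsum n P m Q)"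
proof -
  obtain X Y where P: "P = emb X" and Q: "Q = emb Y"
    using assms is_proj_imp_emb by metis
  show ?thesis
    using assms unfolding P Q dsum_emb is_proj_emb_iff
    by (auto simp: sum_lessThan_add star_zero)
qed

text \<open>The column \<open>x\<close> is a partial isometry from \<open>r\<close> into
  \<open>\<kappa>\<close>. With the complement \<open>R = \<kappa> - x star x\<close>, the matrix
  \<open>(x | R)\<close> is a partial isometry from the direct sum of \<open>r\<close> and
  \<open>R\<close> onto \<open>\<kappa>\<close>, and cancellation reads this as an inequality in
  \<open>K_0\<close>.\<close>

lemma k0_le_of_column:
  assumes canc: "has_cancellation csc star" and K: "is_proj csc star M (emb \<kappa>)"
    and r: "proj star r" and Kx: "\<And>i. (\<Sum>k<M. \<kappa> i k * x k) = x i"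
    and xx: "(\<Sum>i<M. star (x i) * x i) = r" and xr: "\<And>i. x i * r = x i"
  shows "k0_le csc star 1 (mat1 r) M (emb \<kappa>)"
proof -
  have supp: "\<And>i j. M \<le> i \<or> M \<le> j \<Longrightarrow> \<kappa> i j = 0" and sa: "\<And>i j. star (\<kappa> j i) = \<kappa> i j"
    and idem: "\<And>i j. (\<Sum>k<M. \<kappa> i k * \<kappa> k j) = \<kappa> i j"
    using K by (auto simp: is_proj_emb_iff)
  have x0: "x i = 0" if "M \<le> i" for i using Kx[of i] supp that by simp
  have xK: "(\<Sum>k<M. star (x k) * \<kappa> k j) = star (x j)" for j
    using arg_cong[OF Kx[of j], of star] by (simp add: star_sum star_mult sa)
  have rx: "r * star (x j) = star (x j)" for j
    using arg_cong[OF xr[of j], of star] by (simp add: star_mult projD[OF r])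
  define R where "R i j = \<kappa> i j - x i * star (x j)" for i j
  have xR: "(\<Sum>k<M. star (x k) * R k j) = 0" for j
  proof -
    have "(\<Sum>k<M. star (x k) * R k j) = (\<Sum>k<M. star (x k) * \<kappa> k j) - (\<Sum>k<M. star (x k) * x k) * star (x j)"
      by (simp add: R_def right_diff_distrib sum_subtractf sum_distrib_right mult.assoc)
    then show ?thesis by (simp add: xK xx rx)
  qed
  have KR: "(\<Sum>k<M. \<kappa> i k * R k j) = R i j" for i j
  proof -
    have "(\<Sum>k<M. \<kappa> i k * R k j) = (\<Sum>k<M. \<kappa> i k * \<kappa> k j) - (\<Sum>k<M. \<kappa> i k * x k) * star (x j)"
      by (simp add: R_def right_diff_distrib sum_subtractf sum_distrib_right mult.assoc)
    then show ?thesis by (simp add: idem Kx R_def)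
  qed
  have RR: "(\<Sum>k<M. R i k * R k j) = R i j" for i j
  proof -
    have "(\<Sum>k<M. R i k * R k j) = (\<Sum>k<M. \<kappa> i k * R k j) - x i * (\<Sum>k<M. star (x k) * R k j)"
      by (subst (1) R_def) (simp add: left_diff_distrib sum_subtractf sum_distrib_left mult.assoc)
    then show ?thesis by (simp add: KR xR)
  qed
  have R0: "R i j = 0" if "M \<le> i \<or> M \<le> j" for i j
    using that x0 supp by (auto simp: R_def star_zero)
  have Rs: "star (R j i) = R i j" for i j
    by (simp add: R_def star_diff star_mult star_star sa)
  have R: "is_proj csc star M (emb R)"
    using R0 Rs RR by (auto simp: is_proj_emb_iff)
  have Rx: "(\<Sum>k<M. R i k * x k) = 0" for i
    using arg_cong[OF xR[of i], of star] by (simp add: star_sum star_mult star_star Rs star_zero)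
  define D where "D = dsum 1 (mat1 r) M (emb R)"
  have D: "is_proj csc star (1 + M) D"
    unfolding D_def by (rule is_proj_dsum[OF is_proj_mat1[OF r] R])
  \<comment> \<open>Column 0 is \<open>x\<close> and the columns of \<open>R\<close> are shifted by
    one; row \<open>M\<close> is zero, which pads the matrix to the square size
    \<open>Suc M\<close>.\<close>
  define T where "T i j = (case j of 0 \<Rightarrow> x i | Suc j \<Rightarrow> R i j)" for i j
  have "mvn_A csc star (1 + M) D M (emb \<kappa>)"
    unfolding mvn_A_def
  proof (intro exI[of _ "Suc M"] exI[of _ "emb T"] conjI)
    show "msupp (Suc M) (emb T)"
      using R0 x0 by (auto simp: msupp_emb T_def split: nat.split)
    have "(\<Sum>k<Suc M. star (T k i) * T k j) =
        (if i < 1 \<and> j < 1 then (if i = 0 \<and> j = 0 then r else 0)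
         else if 1 \<le> i \<and> 1 \<le> j then R (i - 1) (j - 1) else 0)" for i j
    proof -
      have "T M j = 0" using R0 x0 by (auto simp: T_def split: nat.split)
      then have "(\<Sum>k<Suc M. star (T k i) * T k j) = (\<Sum>k<M. star (T k i) * T k j)" by simp
      also have "\<dots> = (if i < 1 \<and> j < 1 then (if i = 0 \<and> j = 0 then r else 0)
         else if 1 \<le> i \<and> 1 \<le> j then R (i - 1) (j - 1) else 0)"
        by (cases i; cases j) (simp_all add: T_def xx xR Rs Rx RR)
      finally show ?thesis .
    qed
    then show "mmul csc (Suc M) (mstar star (emb T)) (emb T) = D"
      unfolding D_def mat1_emb dsum_emb mstar_emb mmul_emb emb_eq_iff by blast
    have "(\<Sum>k<Suc M. T i k * star (T j k)) = \<kappa> i j" for i j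
      unfolding sum.lessThan_Suc_shift by (simp add: T_def Rs RR) (simp add: R_def)
    then show "mmul csc (Suc M) (emb T) (mstar star (emb T)) = emb \<kappa>"
      unfolding mstar_emb mmul_emb emb_eq_iff by blast
  qed (auto simp: in_A_emb)
  then have "k0_eq csc star (1 + M) D M (emb \<kappa>)"
    using canc D K unfolding has_cancellation_def by blast
  then show ?thesis unfolding k0_le_def D_def using R by blast
qed

text \<open>Converse direction: cancellation provides a partial isometry \<open>V\<close> from the
  direct sum of \<open>p\<close> and some \<open>Q\<close> onto \<open>\<gamma>\<close>, and the
  column of \<open>V\<close> belonging to \<open>p\<close>, cut down by \<open>p\<close>, is the
  required one.\<close>

lemma ex_column_of_k0_le:
  assumes canc: "has_cancellation csc star" and G: "is_proj csc star n (emb \<gamma>)"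
    and p: "proj star p" and le: "k0_le csc star 1 (mat1 p) n (emb \<gamma>)"
  shows "\<exists>x. (\<forall>i. (\<Sum>k<n. \<gamma> i k * x k) = x i) \<and> (\<Sum>i<n. star (x i) * x i) = p"
proof -
  obtain l Q where Q: "is_proj csc star l Q" and "k0_eq csc star (1 + l) (dsum 1 (mat1 p) l Q) n (emb \<gamma>)"
    using le unfolding k0_le_def by blast
  then have "mvn_A csc star (1 + l) (dsum 1 (mat1 p) l Q) n (emb \<gamma>)"
    using canc is_proj_dsum[OF is_proj_mat1[OF p] Q] G unfolding has_cancellation_def by blast
  then obtain N W where N: "1 + l \<le> N" "n \<le> N" and W: "in_A W"
    "mmul csc N (mstar star W) W = dsum 1 (mat1 p) l Q" "mmul csc N W (mstar star W) = emb \<gamma>"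
    unfolding mvn_A_def by blast
  obtain V where V: "W = emb V" using W(1) by (rule in_A_imp_emb)
  obtain X where X: "Q = emb X" using Q by (rule is_proj_imp_emb)
  have P0: "(\<Sum>k<N. star (V k 0) * V k j) = (if j = 0 then p else 0)" for j
    using W(2) unfolding V X mat1_emb dsum_emb mstar_emb mmul_emb emb_eq_iff by auto
  have P0': "(\<Sum>k<N. star (V k j) * V k 0) = (if j = 0 then p else 0)" for j
    using W(2) unfolding V X mat1_emb dsum_emb mstar_emb mmul_emb emb_eq_iff by auto
  have \<gamma>: "(\<Sum>k<N. V i k * star (V j k)) = \<gamma> i j" for i j
    using W(3) unfolding V mstar_emb mmul_emb emb_eq_iff by blast
  have supp: "\<And>i j. n \<le> i \<or> n \<le> j \<Longrightarrow> \<gamma> i j = 0" and sa: "\<And>i j. star (\<gamma> j i) = \<gamma> i j"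
    and idem: "\<And>i j. (\<Sum>k<n. \<gamma> i k * \<gamma> k j) = \<gamma> i j"
    using G by (auto simp: is_proj_emb_iff)
  \<comment> \<open>Multiplying column 0 of \<open>V\<close> by \<open>\<gamma>\<close> gives
    invariance under \<open>\<gamma>\<close> and vanishing from row \<open>n\<close> on. Since
    \<open>\<gamma>\<close> is \<open>V\<close> times its adjoint, the result is also
    \<open>V i 0 * p\<close>, from which the square sum \<open>p\<close> follows.\<close>
  define x where "x i = (\<Sum>k<n. \<gamma> i k * V k 0)" for i
  have Gx: "(\<Sum>k<n. \<gamma> i k * x k) = x i" for i
  proof -
    have "(\<Sum>k<n. \<gamma> i k * x k) = (\<Sum>k<n. \<Sum>j<n. \<gamma> i k * \<gamma> k j * V j 0)"
      by (simp add: x_def sum_distrib_left mult.assoc)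
    also have "\<dots> = (\<Sum>j<n. (\<Sum>k<n. \<gamma> i k * \<gamma> k j) * V j 0)"
      by (subst sum.swap) (simp add: sum_distrib_right)
    finally show ?thesis by (simp add: idem x_def)
  qed
  have ext: "(\<Sum>k<n. f k) = (\<Sum>k<N. f k)" if "\<And>k. n \<le> k \<Longrightarrow> f k = 0" for f :: "nat \<Rightarrow> 'a"
    using N(2) that by (intro sum.mono_neutral_left) auto
  have xV: "x i = V i 0 * p" for i
  proof -
    have "x i = (\<Sum>k<N. \<gamma> i k * V k 0)" unfolding x_def by (rule ext) (simp add: supp)
    also have "\<dots> = (\<Sum>k<N. \<Sum>j<N. V i j * (star (V k j) * V k 0))"
      by (simp add: sum_distrib_right mult.assoc flip: \<gamma>)
    also have "\<dots> = (\<Sum>j<N. V i j * (\<Sum>k<N. star (V k j) * V k 0))"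
      by (subst sum.swap) (simp add: sum_distrib_left)
    also have "\<dots> = V i 0 * p"
      using N(1) by (simp add: P0' if_distrib cong: if_cong)
    finally show ?thesis .
  qed
  have "x i = 0" if "n \<le> i" for i using that by (simp add: x_def supp)
  then have "(\<Sum>i<n. star (x i) * x i) = (\<Sum>i<N. star (x i) * x i)"
    by (intro ext) simp
  also have "\<dots> = p * (\<Sum>i<N. star (V i 0) * V i 0) * p"
    by (simp add: xV star_mult projD[OF p] sum_distrib_left sum_distrib_right mult.assoc)
  also have "\<dots> = p" by (simp add: P0 projD[OF p])
  finally show ?thesis using Gx by blast
qed

text \<open>Columns \<open>x\<close> and \<open>y\<close> carry \<open>p\<close> and
  \<open>q\<close> into \<open>G\<close> and \<open>H\<close>. Stacking \<open>x v\<close> on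
  \<open>y w\<close> gives a column with square sum
  \<open>star v * p * v + star w * q * w = r\<close>, which carries \<open>r\<close> into the direct
  sum.\<close>

lemma k0_le_dsum:
  assumes canc: "has_cancellation csc star"
    and G: "is_proj csc star n G" and H: "is_proj csc star m H"
    and p: "proj star p" "k0_le csc star 1 (mat1 p) n G"
    and q: "proj star q" "k0_le csc star 1 (mat1 q) m H"
    and r: "proj star r" and v: "p * v = v" "v * r = v" and w: "q * w = w" "w * r = w"
    and vw: "star v * v + star w * w = r"
  shows "k0_le csc star 1 (mat1 r) (n + m) (dsum n G m H)"
proof -
  obtain \<gamma> where \<gamma>: "G = emb \<gamma>" using G by (rule is_proj_imp_emb)
  obtain \<theta> where \<theta>: "H = emb \<theta>" using H by (rule is_proj_imp_emb)
  obtain x where x: "\<And>i. (\<Sum>k<n. \<gamma> i k * x k) = x i" "(\<Sum>i<n. star (x i) * x i) = p"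
    using ex_column_of_k0_le[OF canc G[unfolded \<gamma>] p(1) p(2)[unfolded \<gamma>]] by blast
  obtain y where y: "\<And>i. (\<Sum>k<m. \<theta> i k * y k) = y i" "(\<Sum>i<m. star (y i) * y i) = q"
    using ex_column_of_k0_le[OF canc H[unfolded \<theta>] q(1) q(2)[unfolded \<theta>]] by blast
  define u where "u i = (if i < n then x i * v else y (i - n) * w)" for i
  have K: "is_proj csc star (n + m) (dsum n (emb \<gamma>) m (emb \<theta>))"
    using is_proj_dsum[OF G H] by (simp add: \<gamma> \<theta>)
  show ?thesis
    unfolding \<gamma> \<theta> dsum_emb
  proof (rule k0_le_of_column[OF canc K[unfolded dsum_emb] r])
    fix i
    show "u i * r = u i" by (simp add: u_def mult.assoc v w)
    have "(\<Sum>k<n. \<gamma> i k * (x k * v)) = x i * v"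
      by (simp add: x(1) flip: mult.assoc sum_distrib_right)
    moreover have "(\<Sum>k<m. \<theta> (i - n) k * (y k * w)) = y (i - n) * w"
      by (simp add: y(1) flip: mult.assoc sum_distrib_right)
    ultimately show "(\<Sum>k<n + m. (if i < n \<and> k < n then \<gamma> i k
        else if n \<le> i \<and> n \<le> k then \<theta> (i - n) (k - n) else 0) * u k) = u i"
      by (auto simp: sum_lessThan_add u_def)
  next
    have "(\<Sum>i<n. star (x i * v) * (x i * v)) = star v * (\<Sum>i<n. star (x i) * x i) * v"
      by (simp add: star_mult sum_distrib_left sum_distrib_right mult.assoc)
    moreover have "(\<Sum>i<m. star (y i * w) * (y i * w)) = star w * (\<Sum>i<m. star (y i) * y i) * w"
      by (simp add: star_mult sum_distrib_left sum_distrib_right mult.assoc)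
    ultimately show "(\<Sum>i<n + m. star (u i) * u i) = r"
      by (simp add: sum_lessThan_add u_def x(2) y(2) mult.assoc v w vw)
  qed
qed

text \<open>The zero projection competes in every singular value, so no infimum is taken over the
  empty set.\<close>

lemma k0_le_zero:
  assumes "has_cancellation csc star" "is_proj csc star n G"
  shows "k0_le csc star 1 (mat1 0) n G"
proof -
  obtain \<gamma> where \<gamma>: "G = emb \<gamma>" using assms(2) by (rule is_proj_imp_emb)
  show ?thesis
    using k0_le_of_column[OF assms(1) assms(2)[unfolded \<gamma>], of 0 "\<lambda>_. 0"]
    by (simp add: \<gamma> proj_def star_zero)
qed

section \<open>The product inequality, first for competing projections and then for infima\<close>

lemma ex_proj_norm_mult_le:
  assumes rr: "real_rank_zero csc star" and canc: "has_cancellation csc star"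
    and G: "is_proj csc star n G" and H: "is_proj csc star m H"
    and p: "proj star p" "k0_le csc star 1 (mat1 p) n G"
    and q: "proj star q" "k0_le csc star 1 (mat1 q) m H"
    and \<epsilon>: "\<epsilon> > 0"
  shows "\<exists>r. proj star r \<and> k0_le csc star 1 (mat1 r) (n + m) (dsum n G m H) \<and>
    norm (a * b - a * b * r) \<le> norm (a - a * p) * norm (b - b * q) + \<epsilon>"
proof -
  define c where "c = p * b - p * b * q"
  have cq: "c * q = 0" by (simp add: c_def left_diff_distrib mult.assoc projD[OF q(1)])
  \<comment> \<open>Total weight of the errors \<open>c - c r\<close> and \<open>q - q r\<close>;
    the summand 1 keeps the divisor positive.\<close>
  define C where "C = norm a + norm (a * b) + 1"
  have C: "C > 0" by (simp add: C_def add_nonneg_pos)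
  obtain r t where r: "proj star r" and cr: "norm (c - c * r) \<le> \<epsilon> / C" and qr: "norm (q - q * r) \<le> \<epsilon> / C"
    and t: "star t * (star c * c + q) * t = r" "t * r = t"
    using ex_approximate_support[OF rr q(1) cq, of "\<epsilon> / C"] \<epsilon> C by auto
  have "k0_le csc star 1 (mat1 r) (n + m) (dsum n G m H)"
  proof (rule k0_le_dsum[OF canc G H p q r])
    have "p * c = c" by (simp add: c_def right_diff_distrib proj_mult_cancel[OF p(1)] mult.assoc)
    then show "p * (c * t) = c * t" by (simp flip: mult.assoc)
    show "c * t * r = c * t" "q * t * r = q * t" by (simp_all add: mult.assoc t)
    show "q * (q * t) = q * t" by (rule proj_mult_cancel[OF q(1)])
    have "star (c * t) * (c * t) + star (q * t) * (q * t) = star t * (star c * c + q) * t"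
      by (simp add: star_mult projD[OF q(1)] proj_mult_cancel[OF q(1)] algebra_simps)
    then show "star (c * t) * (c * t) + star (q * t) * (q * t) = r" by (simp add: t)
  qed
  moreover have "norm (a * b - a * b * r) \<le> norm (a - a * p) * norm (b - b * q) + \<epsilon>"
  proof -
    define x where "x = (a - a * p) * (b - b * q)"
    have "a * b = x + (a * c + a * b * q)" by (simp add: x_def c_def algebra_simps)
    then have "a * b - a * b * r = (x + (a * c + a * b * q)) - (x + (a * c + a * b * q)) * r" by simp
    also have "\<dots> = (x - x * r) + (a * (c - c * r) + a * b * (q - q * r))"
      by (simp add: algebra_simps)
    finally have "norm (a * b - a * b * r) \<le> norm (x - x * r) + norm (a * (c - c * r) + a * b * (q - q * r))"
      by (simp only: norm_triangle_ineq)
    also have "norm (x - x * r) \<le> norm (a - a * p) * norm (b - b * q)"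
      using norm_diff_proj_right[OF r, of x] norm_mult_ineq[of "a - a * p" "b - b * q"] by (simp add: x_def)
    also have "norm (a * (c - c * r) + a * b * (q - q * r)) \<le> norm a * (\<epsilon> / C) + norm (a * b) * (\<epsilon> / C)"
      by (intro order_trans[OF norm_triangle_ineq] add_mono order_trans[OF norm_mult_ineq] mult_left_mono cr qr) simp_all
    also have "\<dots> = (norm a + norm (a * b)) * (\<epsilon> / C)" by (simp only: distrib_right)
    also have "\<dots> \<le> C * (\<epsilon> / C)" using \<epsilon> C by (intro mult_right_mono) (auto simp: C_def)
    also have "\<dots> = \<epsilon>" using C by simp
    finally show ?thesis by simp
  qed
  ultimately show ?thesis using r by blast
qed

text \<open>The bound for single competitors passes to the infimum one factor at a time by division,
  so a factor equal to 0 is treated separately.\<close>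

lemma sval_dsum_mult_le:
  assumes rr: "real_rank_zero csc star" and canc: "has_cancellation csc star"
    and G: "is_proj csc star n G" and H: "is_proj csc star m H"
  shows "sval csc star (n + m) (dsum n G m H) (a * b) \<le> sval csc star n G a * sval csc star m H b"
proof -
  define S where "S k R x = {norm (x - x * p) | p. proj star p \<and> k0_le csc star 1 (mat1 p) k R}" for k R x
  have sval: "sval csc star k R x = Inf (S k R x)" for k R x by (simp add: sval_def S_def)
  have bdd: "bdd_below (S k R x)" for k R x by (rule bdd_belowI[of _ 0]) (auto simp: S_def)
  have ne: "S k R x \<noteq> {}" if "is_proj csc star k R" for k R x
    using k0_le_zero[OF canc that] by (auto simp: S_def proj_def star_zero intro!: exI[of _ 0])
  define I where "I = sval csc star (n + m) (dsum n G m H) (a * b)"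
  have le: "I \<le> \<alpha> * \<beta>" if \<alpha>: "\<alpha> \<in> S n G a" and \<beta>: "\<beta> \<in> S m H b" for \<alpha> \<beta>
  proof (rule field_le_epsilon)
    fix \<epsilon> :: real assume "\<epsilon> > 0"
    obtain p where p: "proj star p" "k0_le csc star 1 (mat1 p) n G" "\<alpha> = norm (a - a * p)"
      using \<alpha> by (auto simp: S_def)
    obtain q where q: "proj star q" "k0_le csc star 1 (mat1 q) m H" "\<beta> = norm (b - b * q)"
      using \<beta> by (auto simp: S_def)
    obtain r where r: "proj star r" "k0_le csc star 1 (mat1 r) (n + m) (dsum n G m H)"
      "norm (a * b - a * b * r) \<le> \<alpha> * \<beta> + \<epsilon>"
      using ex_proj_norm_mult_le[OF rr canc G H p(1,2) q(1,2) \<open>\<epsilon> > 0\<close>, of a b] unfolding p(3) q(3) by blast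
    have "I \<le> norm (a * b - a * b * r)"
      unfolding I_def sval by (rule cInf_lower[OF _ bdd]) (use r in \<open>auto simp: S_def\<close>)
    then show "I \<le> \<alpha> * \<beta> + \<epsilon>" using r(3) by simp
  qed
  have nonneg: "0 \<le> \<alpha>" if "\<alpha> \<in> S k R x" for \<alpha> k R x using that by (auto simp: S_def)
  have Inf0: "0 \<le> Inf (S k R x)" if "is_proj csc star k R" for k R x
    by (rule cInf_greatest[OF ne[OF that] nonneg])
  have step: "I \<le> \<alpha> * Inf (S m H b)" if \<alpha>: "\<alpha> \<in> S n G a" for \<alpha>
  proof (cases "\<alpha> = 0")
    case True
    obtain \<beta> where "\<beta> \<in> S m H b" using ne[OF H] by blast
    then show ?thesis using le[OF \<alpha>] True by force
  next
    case False
    then have "\<alpha> > 0" using nonneg[OF \<alpha>] by simp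
    then have "I / \<alpha> \<le> Inf (S m H b)"
      using le[OF \<alpha>] by (intro cInf_greatest[OF ne[OF H]]) (simp add: field_simps)
    then show ?thesis using \<open>\<alpha> > 0\<close> by (simp add: field_simps)
  qed
  show ?thesis
  proof (cases "Inf (S m H b) = 0")
    case True
    obtain \<alpha> where "\<alpha> \<in> S n G a" using ne[OF G] by blast
    then show ?thesis using step True by (force simp: sval I_def)
  next
    case False
    then have pos: "Inf (S m H b) > 0" using Inf0[OF H] by (simp add: less_le)
    then have "I / Inf (S m H b) \<le> Inf (S n G a)"
      using step by (intro cInf_greatest[OF ne[OF G]]) (simp add: field_simps)
    then show ?thesis using pos by (simp add: field_simps sval I_def)
  qed
qed

end

theorem theorem3p16:
  fixes csc :: "complex \<Rightarrow> 'a::{real_normed_algebra,banach} \<Rightarrow> 'a"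
    and star :: "'a \<Rightarrow> 'a"
  assumes "cstar_algebra csc star"
    and "has_cancellation csc star"
    and "real_rank_zero csc star"
    and "k0pos_eq_D0 csc star"
  shows "\<forall>a b n G m H. is_proj csc star n G \<longrightarrow> is_proj csc star m H \<longrightarrow>
           sval csc star (n + m) (dsum n G m H) (a * b)
             \<le> sval csc star n G a * sval csc star m H b"
proof -
  interpret cstar csc star by unfold_locales (rule assms(1))
  show ?thesis using sval_dsum_mult_le assms(2,3) by blast
qed

end
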